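(* Let $\{Z_i,i\ge1\}$ be independent symmetric random variables with a common mean $\mu$ (i.e. each $Z_i$ is symmetric around $\mu$). Let $\widetilde T_n^t(Z_1-\mu,\ldots,Z_n-\mu)$, $0\le t\le1$, be the Student process defined in the context. Then $$\widetilde T_n^t(Z_1-\mu,\ldots,Z_n-\mu)\xrightarrow{\mathcal D}W(t)\ \text{ on }(D[0,1],\rho)\quad\text{as } n\to\infty$$ if and only if $$\frac{\max_{1\le i\le n}(Z_i-\mu)^2}{\sum_{i=1}^n(Z_i-\mu)^2}\xrightarrow{P}0\quad\text{as } n\to\infty.$$
   Context: The $Z_i$ are not assumed to be identically distributed or to have finite variances. Notation: $\overline Z:=n^{-1}\sum_{i=1}^nZ_i$; empty sums $\sum_{i=1}^0$ are $0$. For $0\le t\le1$, $\widetilde K_n(t)$ is the largest integer $m\in\{0,1,\ldots,n\}$ with $\sum_{i=1}^m(Z_i-\overline Z)^2\le t\sum_{i=1}^n(Z_i-\overline Z)^2$, and $$\widetilde T_n^t(Z_1-\mu,\ldots,Z_n-\mu):=\frac{\sum_{i=1}^{\widetilde K_n(t)}(Z_i-\mu)/\sqrt n}{\left(\sum_{i=1}^n(Z_i-\overline Z)^2/(n-1)\right)^{1/2}},\quad 0\le t\le1$$ (centering by $\mu$ changes neither $\widetilde K_n$ nor the denominator). $\{W(t),0\le t\le1\}$ is a standard Wiener process, $D[0,1]$ is the space of right-continuous functions with left limits (càdlàg) on $[0,1]$, $\rho$ is the sup-norm metric on $D[0,1]$, and $\mathcal D$ is the sigma-field of subsets of $D[0,1]$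 generated by its finite-dimensional subsets. For processes $X_n$ in $D[0,1]$, "$X_n(t)\xrightarrow{\mathcal D}W(t)$ on $(D[0,1],\rho)$" means that $h(X_n(\cdot))\xrightarrow{\mathcal D}h(W(\cdot))$ for all functionals $h:D[0,1]\to\mathbb R$ that are $\mathcal D$-measurable and $\rho$-continuous, or $\rho$-continuous except at points forming a set of Wiener measure zero on $(D[0,1],\mathcal D)$. *)

theory Defs
  imports "HOL-Probability.Probability"
begin

text \<open>Functions on \<open>[0,1]\<close> are represented by extensional functions, i.e. functions on the
  reals that are \<open>undefined\<close> outside \<open>[0,1]\<close>.\<close>

definition D01 :: "(real \<Rightarrow> real) set" where
  "D01 = {x \<in> extensional {0..1}.
      (\<forall>t\<in>{0..<1}. (x \<longlongrightarrow> x t) (at_right t)) \<and>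
      (\<forall>t\<in>{0<..1}. \<exists>l. (x \<longlongrightarrow> l) (at_left t))}"

definition sup_dist :: "(real \<Rightarrow> real) \<Rightarrow> (real \<Rightarrow> real) \<Rightarrow> real" where
  "sup_dist x y = (SUP t\<in>{0..1}. \<bar>x t - y t\<bar>)"

definition sup_continuous_at :: "((real \<Rightarrow> real) \<Rightarrow> real) \<Rightarrow> (real \<Rightarrow> real) \<Rightarrow> bool" where
  "sup_continuous_at h x \<longleftrightarrow>
     (\<forall>\<epsilon>>0. \<exists>\<delta>>0. \<forall>y\<in>D01. sup_dist x y < \<delta> \<longrightarrow> \<bar>h x - h y\<bar> < \<epsilon>)"

text \<open>The sigma-field on \<open>D[0,1]\<close> generated by the finite-dimensional (cylinder) sets. The measure
  carried by \<^const>\<open>sigma\<close> is irrelevant; only the space and the measurable sets are used.\<close>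

definition D01_algebra :: "(real \<Rightarrow> real) measure" where
  "D01_algebra = sigma D01
     {{x \<in> D01. restrict x J \<in> B} | J B.
        finite J \<and> J \<subseteq> {0..1} \<and> B \<in> sets (\<Pi>\<^sub>M t\<in>J. (borel :: real measure))}"

definition path :: "(real \<Rightarrow> 'a \<Rightarrow> real) \<Rightarrow> 'a \<Rightarrow> real \<Rightarrow> real" where
  "path X \<omega> = (\<lambda>t\<in>{0..1}. X t \<omega>)"

definition wiener_process :: "'a measure \<Rightarrow> (real \<Rightarrow> 'a \<Rightarrow> real) \<Rightarrow> bool" where
  "wiener_process N W \<longleftrightarrow>
     prob_space N \<and>
     (\<forall>t\<in>{0..1}. W t \<in> borel_measurable N) \<and>
     (AE \<omega> in N. W 0 \<omega> = 0) \<and>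
     (\<forall>\<omega>\<in>space N. continuous_on {0..1} (\<lambda>t. W t \<omega>)) \<and>
     (\<forall>s t. 0 \<le> s \<and> s < t \<and> t \<le> 1 \<longrightarrow>
        distributed N lborel (\<lambda>\<omega>. W t \<omega> - W s \<omega>) (normal_density 0 (sqrt (t - s)))) \<and>
     (\<forall>(k::nat) \<tau>. (\<forall>i\<le>k. \<tau> i \<in> {0..1}) \<and> (\<forall>i<k. \<tau> i < \<tau> (Suc i)) \<longrightarrow>
        prob_space.indep_vars N (\<lambda>_. borel) (\<lambda>i \<omega>. W (\<tau> (Suc i)) \<omega> - W (\<tau> i) \<omega>) {..<k})"

text \<open>Convergence in distribution on \<open>(D[0,1], \<rho>)\<close>: the laws of \<open>h (X\<^sub>n)\<close> converge weakly to the
  law of \<open>h (W)\<close> for every measurable \<open>h\<close> that is \<open>\<rho>\<close>-continuous outside a null set of the law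
  of \<open>W\<close> (Wiener measure). Functionals that are continuous everywhere are included.\<close>

definition converges_in_distr_D01 ::
  "'a measure \<Rightarrow> (nat \<Rightarrow> real \<Rightarrow> 'a \<Rightarrow> real) \<Rightarrow> 'b measure \<Rightarrow> (real \<Rightarrow> 'b \<Rightarrow> real) \<Rightarrow> bool" where
  "converges_in_distr_D01 M X N W \<longleftrightarrow>
     (\<forall>h \<in> borel_measurable D01_algebra.
        (AE x in distr N D01_algebra (path W). sup_continuous_at h x) \<longrightarrow>
        weak_conv_m (\<lambda>n. distr M borel (\<lambda>\<omega>. h (path (X n) \<omega>)))
                    (distr N borel (\<lambda>\<omega>. h (path W \<omega>))))"

definition converges_in_prob :: "'a measure \<Rightarrow> (nat \<Rightarrow> 'a \<Rightarrow> real) \<Rightarrow> real \<Rightarrow> bool" where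
  "converges_in_prob M X c \<longleftrightarrow>
     (\<forall>\<epsilon>>0. (\<lambda>n. measure M {\<omega> \<in> space M. \<bar>X n \<omega> - c\<bar> > \<epsilon>}) \<longlonglongrightarrow> 0)"

definition sample_mean :: "nat \<Rightarrow> (nat \<Rightarrow> real) \<Rightarrow> real" where
  "sample_mean n z = (\<Sum>i=1..n. z i) / real n"

definition student_index :: "nat \<Rightarrow> (nat \<Rightarrow> real) \<Rightarrow> real \<Rightarrow> nat" where
  "student_index n z t = Max {m \<in> {0..n}.
     (\<Sum>i=1..m. (z i - sample_mean n z)\<^sup>2) \<le> t * (\<Sum>i=1..n. (z i - sample_mean n z)\<^sup>2)}"

text \<open>If the denominator vanishes (all observations are equal), the value is 0 by the convention
  \<open>x / 0 = 0\<close>.\<close>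

definition student_process :: "nat \<Rightarrow> real \<Rightarrow> (nat \<Rightarrow> real) \<Rightarrow> real \<Rightarrow> real" where
  "student_process n \<mu> z t =
     ((\<Sum>i=1..student_index n z t. (z i - \<mu>)) / sqrt (real n)) /
     sqrt ((\<Sum>i=1..n. (z i - sample_mean n z)\<^sup>2) / (real n - 1))"

text \<open>The ratio is undefined when all \<open>z i\<close> equal \<open>\<mu>\<close>. With \<open>0 / 0 = 0\<close> this event would count
  in favour of convergence to 0, and for observations identically equal to \<open>\<mu>\<close> the ratio would
  converge to 0. Undefined ratios are therefore assigned the value 1, so that convergence to 0
  entails that the ratio is defined with probability tending to 1.\<close>

definition max_ratio :: "nat \<Rightarrow> real \<Rightarrow> (nat \<Rightarrow> real) \<Rightarrow> real" where
  "max_ratio n \<mu> z =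
     (if (\<Sum>i=1..n. (z i - \<mu>)\<^sup>2) = 0 then 1
      else (MAX i\<in>{1..n}. (z i - \<mu>)\<^sup>2) / (\<Sum>i=1..n. (z i - \<mu>)\<^sup>2))"

end

theory Submission
  imports Defs
begin

text \<open>
  Necessity: if one observation carries a fixed fraction of the sum of squares, then the random clock,
  and with it the Student process, is constant on an interval of fixed length. Hence the smallest
  increment over a fine grid vanishes, an event of probability 0 for a Wiener process.

  Sufficiency: the law of the centred observations is invariant under sign changes, so it is enough to
  treat \<open>e\<^sub>1 a\<^sub>1, \<dots>, e\<^sub>n a\<^sub>n\<close> with deterministic \<open>a\<^sub>i\<close> and independent random signs \<open>e\<^sub>i\<close>, uniformly in all \<open>a\<close>
  with small maximal ratio. Cut \<open>{1, \<dots>, n}\<close> into \<open>m\<close> blocks of nearly equal variance. The block sums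
  are independent and asymptotically normal, their oscillations are controlled by a fourth-moment
  maximal inequality, and the sample mean distorts the random clock only by \<open>O(1/n)\<close>; so up to a small
  error the Student process is the step function through the block sums. A functional that is
  continuous at almost every Wiener path is treated by open sets of grid values for which a
  uniform neighbourhood of the step function lies in a sublevel set; this avoids separability and
  compactness in \<open>D[0,1]\<close>.
\<close>

subsection \<open>The path space\<close>

text \<open>Only lower bounds for probabilities of the form P(h < x) are ever proved; the upper
  bounds come from applying them to \<open>- h\<close> at \<open>- x\<close>. This one-sidedness
  allows a sublevel set to be approximated from inside by sets that depend on finitely many
  coordinates, although the sup norm on D[0,1] is not separable and its open sets need not belong to
  the cylinder sigma-field. The radius \<eta> of the uniform neighbourhoods comes from the Wiener
  side, before the number m of blocks is chosen, so at fixed \<eta> the oscillation inside m blocks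
  of variance about 1/m must vanish as m grows. A union bound with second moments is of order
  1/\<eta>^2, which does not shrink; fourth moments give the order 1/(m \<eta>^4). This is why the
  maximal inequality is of fourth order.\<close>

lemma D01_bounded:
  assumes "x \<in> D01"
  shows "\<exists>B. \<forall>t\<in>{0..1}. \<bar>x t\<bar> \<le> B"
proof -
  have right: "(x \<longlongrightarrow> x t) (at_right t)" if "0 \<le> t" "t < 1" for t
    using assms that by (auto simp: D01_def)
  have left: "\<exists>l. (x \<longlongrightarrow> l) (at_left t)" if "0 < t" "t \<le> 1" for t
    using assms that by (auto simp: D01_def)
  \<comment> \<open>\<open>Bolzano\<close> quantifies over all short intervals around a point,
    including those that stick out of [0,1]; hence the intersection with
    \<open>{0..1}\<close>.\<close>
  define P where "P a b \<longleftrightarrow> (\<exists>B. \<forall>t\<in>{a..b} \<inter> {0..1}. \<bar>x t\<bar> \<le> B)" for a b :: real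
  have "P 0 1"
  proof (rule Bolzano)
    fix a b c :: real
    assume "P a b" "P b c" and le: "a \<le> b" "b \<le> c"
    then obtain B C where "\<forall>t\<in>{a..b} \<inter> {0..1}. \<bar>x t\<bar> \<le> B" "\<forall>t\<in>{b..c} \<inter> {0..1}. \<bar>x t\<bar> \<le> C"
      unfolding P_def by blast
    then have "\<forall>t\<in>{a..c} \<inter> {0..1}. \<bar>x t\<bar> \<le> max B C"
      using le by (metis IntE IntI atLeastAtMost_iff max.coboundedI1 max.coboundedI2 nle_le)
    then show "P a c" unfolding P_def by blast
  next
    fix t :: real
    assume t: "0 \<le> t" "t \<le> 1"
    have "\<exists>d>0. \<exists>B. \<forall>s. t < s \<and> s < t + d \<and> s \<le> 1 \<longrightarrow> \<bar>x s\<bar> \<le> B"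
    proof (cases "t < 1")
      case True
      have "eventually (\<lambda>s. dist (x s) (x t) < 1) (at_right t)"
        using right[OF t(1) True] by (rule tendstoD) simp
      then obtain b where b: "b > t" "\<And>s. t < s \<Longrightarrow> s < b \<Longrightarrow> dist (x s) (x t) < 1"
        unfolding eventually_at_right_field by blast
      have "\<bar>x s\<bar> \<le> \<bar>x t\<bar> + 1" if "t < s" "s < t + (b - t)" for s
        using b(2)[of s] that by (auto simp: dist_real_def)
      then show ?thesis using b(1) by (intro exI[of _ "b - t"]) auto
    qed (auto intro!: exI[of _ 1])
    then obtain d1 B1 where d1: "d1 > 0" "\<And>s. t < s \<Longrightarrow> s < t + d1 \<Longrightarrow> s \<le> 1 \<Longrightarrow> \<bar>x s\<bar> \<le> B1"
      by blast
    have "\<exists>d>0. \<exists>B. \<forall>s. s < t \<and> t - d < s \<and> 0 \<le> s \<longrightarrow> \<bar>x s\<bar> \<le> B"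
    proof (cases "0 < t")
      case True
      then obtain l where "(x \<longlongrightarrow> l) (at_left t)" using left t by blast
      then have "eventually (\<lambda>s. dist (x s) l < 1) (at_left t)"
        by (rule tendstoD) simp
      then obtain b where b: "b < t" "\<And>s. b < s \<Longrightarrow> s < t \<Longrightarrow> dist (x s) l < 1"
        unfolding eventually_at_left_field by blast
      have "\<bar>x s\<bar> \<le> \<bar>l\<bar> + 1" if "s < t" "t - (t - b) < s" for s
        using b(2)[of s] that by (auto simp: dist_real_def)
      then show ?thesis using b(1) by (intro exI[of _ "t - b"]) auto
    qed (auto intro!: exI[of _ 1])
    then obtain d2 B2 where d2: "d2 > 0" "\<And>s. s < t \<Longrightarrow> t - d2 < s \<Longrightarrow> 0 \<le> s \<Longrightarrow> \<bar>x s\<bar> \<le> B2"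
      by blast
    have "P a b" if "a \<le> t" "t \<le> b" "b - a < min d1 d2" for a b
      unfolding P_def
    proof (intro exI ballI)
      fix s assume s: "s \<in> {a..b} \<inter> {0..1}"
      consider "s < t" | "s = t" | "t < s" by linarith
      then show "\<bar>x s\<bar> \<le> max \<bar>x t\<bar> (max B1 B2)"
        using that s d1(2)[of s] d2(2)[of s] by cases auto
    qed
    then show "\<exists>d>0. \<forall>a b. a \<le> t \<and> t \<le> b \<and> b - a < d \<longrightarrow> P a b"
      using d1(1) d2(1) by (intro exI[of _ "min d1 d2"]) auto
  qed simp
  then show ?thesis unfolding P_def by simp
qed

text \<open>A real \<open>SUP\<close> says nothing about a set that is unbounded above, so
  boundedness of cadlag functions is what makes \<open>sup_dist\<close> a usable distance.\<close>

lemma abs_diff_le_sup_dist: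
  assumes "x \<in> D01" "y \<in> D01" "t \<in> {0..1}"
  shows "\<bar>x t - y t\<bar> \<le> sup_dist x y"
proof -
  obtain A B where "\<forall>t\<in>{0..1}. \<bar>x t\<bar> \<le> A" "\<forall>t\<in>{0..1}. \<bar>y t\<bar> \<le> B"
    using D01_bounded assms by meson
  then have "\<bar>x s - y s\<bar> \<le> A + B" if "s \<in> {0..1}" for s
    using that abs_triangle_ineq4[of "x s" "y s"] by fastforce
  then have "bdd_above ((\<lambda>t. \<bar>x t - y t\<bar>) ` {0..1})"
    by (auto intro!: bdd_aboveI[of _ "A + B"])
  then show ?thesis
    unfolding sup_dist_def using assms(3) by (rule cSUP_upper[rotated])
qed

lemma sup_dist_le:
  assumes "\<And>t. t \<in> {0..1} \<Longrightarrow> \<bar>x t - y t\<bar> \<le> c"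
  shows "sup_dist x y \<le> c"
  unfolding sup_dist_def using assms by (intro cSUP_least) auto

lemma space_D01_algebra [simp]: "space D01_algebra = D01"
  unfolding D01_algebra_def by (rule space_measure_of) auto

lemma sets_D01_algebra:
  "sets D01_algebra = sigma_sets D01 {{x \<in> D01. restrict x J \<in> B} | J B.
        finite J \<and> J \<subseteq> {0..1} \<and> B \<in> sets (\<Pi>\<^sub>M t\<in>J. (borel :: real measure))}"
  unfolding D01_algebra_def by (rule sets_measure_of) auto

lemma measurable_eval_D01 [measurable]:
  assumes "t \<in> {0..1}"
  shows "(\<lambda>x. x t) \<in> borel_measurable D01_algebra"
proof (rule measurableI)
  fix A :: "real set" assume A: "A \<in> sets borel"
  let ?J = "{t}" and ?B = "{f \<in> space (\<Pi>\<^sub>M s\<in>{t}. (borel :: real measure)). f t \<in> A}"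
  have "?B \<in> sets (\<Pi>\<^sub>M s\<in>{t}. (borel :: real measure))"
    using A by measurable
  moreover have "(\<lambda>x. x t) -` A \<inter> D01 = {x \<in> D01. restrict x {t} \<in> ?B}"
    by (auto simp: space_PiM)
  ultimately show "(\<lambda>x. x t) -` A \<inter> space D01_algebra \<in> sets D01_algebra"
    unfolding sets_D01_algebra space_D01_algebra using assms
    by (intro sigma_sets.Basic CollectI exI[of _ "?J"] exI[of _ "?B"]) auto
qed simp

lemma path_measurable:
  assumes X: "\<And>t. t \<in> {0..1} \<Longrightarrow> X t \<in> borel_measurable M"
    and D: "\<And>\<omega>. \<omega> \<in> space M \<Longrightarrow> path X \<omega> \<in> D01"
  shows "path X \<in> measurable M D01_algebra"
  unfolding D01_algebra_def
proof (rule measurable_measure_of)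
  fix A assume "A \<in> {{x \<in> D01. restrict x J \<in> B} | J B.
        finite J \<and> J \<subseteq> {0..1} \<and> B \<in> sets (\<Pi>\<^sub>M t\<in>J. (borel :: real measure))}"
  then obtain J B where A: "A = {x \<in> D01. restrict x J \<in> B}"
    and J: "J \<subseteq> {0..1}" and B: "B \<in> sets (\<Pi>\<^sub>M t\<in>J. (borel :: real measure))" by blast
  have "(\<lambda>\<omega>. \<lambda>t\<in>J. X t \<omega>) \<in> measurable M (\<Pi>\<^sub>M t\<in>J. borel)"
    using X J by (intro measurable_restrict) auto
  then have "(\<lambda>\<omega>. \<lambda>t\<in>J. X t \<omega>) -` B \<inter> space M \<in> sets M"
    using B by (rule measurable_sets)
  moreover have "restrict (path X \<omega>) J = (\<lambda>t\<in>J. X t \<omega>)" for \<omega>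
    using J by (auto simp: path_def fun_eq_iff restrict_def)
  ultimately show "path X -` A \<inter> space M \<in> sets M"
    using D by (simp add: A vimage_def Int_def conj_commute cong: conj_cong)
qed (use D in auto)

lemma wiener_path_in_D01:
  assumes "wiener_process N W" "\<omega> \<in> space N"
  shows "path W \<omega> \<in> D01"
proof -
  have cont: "continuous_on {0..1} (path W \<omega>)"
    using assms by (subst continuous_on_cong[OF refl, of _ _ "\<lambda>t. W t \<omega>"]) (auto simp: wiener_process_def path_def)
  have "(path W \<omega> \<longlongrightarrow> path W \<omega> t) (at_right t)" if t: "0 \<le> t" "t < 1" for t
  proof -
    have "(path W \<omega> \<longlongrightarrow> path W \<omega> t) (at t within {0..1})"
      using cont t by (simp add: continuous_on_def)
    then have "(path W \<omega> \<longlongrightarrow> path W \<omega> t) (at t within {t..1})"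
      by (rule tendsto_within_subset) (use t in auto)
    then show ?thesis using t by (simp add: at_within_Icc_at_right)
  qed
  moreover have "(path W \<omega> \<longlongrightarrow> path W \<omega> t) (at_left t)" if t: "0 < t" "t \<le> 1" for t
  proof -
    have "(path W \<omega> \<longlongrightarrow> path W \<omega> t) (at t within {0..1})"
      using cont t by (simp add: continuous_on_def)
    then have "(path W \<omega> \<longlongrightarrow> path W \<omega> t) (at t within {0..t})"
      by (rule tendsto_within_subset) (use t in auto)
    then show ?thesis using t by (simp add: at_within_Icc_at_left)
  qed
  moreover have "path W \<omega> \<in> extensional {0..1}"
    by (simp add: path_def)
  ultimately show ?thesis
    unfolding D01_def by (intro CollectI conjI ballI) (simp, simp, metis greaterThanAtMost_iff)
qed

lemma path_wiener_measurable:
  assumes "wiener_process N W"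
  shows "path W \<in> measurable N D01_algebra"
  using assms by (intro path_measurable wiener_path_in_D01[OF assms]) (auto simp: wiener_process_def)

subsection \<open>The Student process\<close>

definition centered_ss :: "nat \<Rightarrow> (nat \<Rightarrow> real) \<Rightarrow> nat \<Rightarrow> real" where
  "centered_ss n z m = (\<Sum>i=1..m. (z i - sample_mean n z)\<^sup>2)"

lemma centered_ss_mono: "k \<le> m \<Longrightarrow> centered_ss n z k \<le> centered_ss n z m"
  unfolding centered_ss_def by (rule sum_mono2) auto

lemma centered_ss_nonneg: "0 \<le> centered_ss n z m"
  unfolding centered_ss_def by (simp add: sum_nonneg)

lemma centered_ss_0 [simp]: "centered_ss n z 0 = 0"
  by (simp add: centered_ss_def)

lemma student_index_eq:
  "student_index n z t = Max {m \<in> {0..n}. centered_ss n z m \<le> t * centered_ss n z n}"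
  by (simp add: student_index_def centered_ss_def)

lemma student_process_eq:
  "student_process n \<mu> z t =
     ((\<Sum>i=1..student_index n z t. (z i - \<mu>)) / sqrt (real n)) / sqrt (centered_ss n z n / (real n - 1))"
  by (simp add: student_process_def centered_ss_def)

lemma student_index_props:
  assumes "0 \<le> t"
  shows "student_index n z t \<le> n"
    and "centered_ss n z (student_index n z t) \<le> t * centered_ss n z n"
    and "k \<le> n \<Longrightarrow> centered_ss n z k \<le> t * centered_ss n z n \<Longrightarrow> k \<le> student_index n z t"
proof -
  let ?S = "{m \<in> {0..n}. centered_ss n z m \<le> t * centered_ss n z n}"
  have "0 \<in> ?S"
    using assms by (auto intro!: mult_nonneg_nonneg simp: centered_ss_nonneg)
  then have "Max ?S \<in> ?S"
    by (intro Max_in) auto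
  then show "student_index n z t \<le> n"
    "centered_ss n z (student_index n z t) \<le> t * centered_ss n z n"
    by (auto simp: student_index_eq)
  show "k \<le> student_index n z t" if "k \<le> n" "centered_ss n z k \<le> t * centered_ss n z n"
    unfolding student_index_eq using that by (intro Max_ge) auto
qed

lemma sample_mean_diff:
  assumes "n \<ge> 1"
  shows "sample_mean n (\<lambda>i. z i - c) = sample_mean n z - c"
  using assms by (simp add: sample_mean_def sum_subtractf field_simps)

text \<open>For \<open>n = 0\<close> the sample mean is 0 by division by zero and does not follow a
  shift of the data, so this case is split off. The theorem is thereby reduced to observations
  centred at 0.\<close>

lemma student_process_shift:
  "student_process n \<mu> z t = student_process n 0 (\<lambda>i. z i - \<mu>) t"
proof (cases "n = 0")
  case True
  then show ?thesis by (simp add: student_process_def)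
next
  case False
  then show ?thesis
    by (simp add: student_process_def student_index_def sample_mean_diff)
qed

lemma max_ratio_shift: "max_ratio n \<mu> z = max_ratio n 0 (\<lambda>i. z i - \<mu>)"
  by (simp add: max_ratio_def)

lemma sample_mean_scale: "sample_mean n (\<lambda>i. c * z i) = c * sample_mean n z"
  by (simp add: sample_mean_def flip: sum_distrib_left)

lemma centered_ss_scale: "centered_ss n (\<lambda>i. c * z i) m = c\<^sup>2 * centered_ss n z m"
  by (simp add: centered_ss_def sample_mean_scale sum_distrib_left power_mult_distrib flip: right_diff_distrib)

text \<open>Self-normalisation cancels a positive factor and leaves the clock alone; this later
  allows weights to be scaled to total sum of squares 1.\<close>

lemma student_process_scale:
  assumes "c > 0"
  shows "student_process n 0 (\<lambda>i. c * z i) t = student_process n 0 z t"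
proof -
  have "student_index n (\<lambda>i. c * z i) t = student_index n z t"
    using assms by (simp add: student_index_eq centered_ss_scale mult.left_commute[of t])
  moreover have "sqrt (c\<^sup>2 * centered_ss n z n / (real n - 1)) = c * sqrt (centered_ss n z n / (real n - 1))"
    using assms by (simp add: real_sqrt_mult flip: times_divide_eq_right)
  ultimately show ?thesis
    using assms by (simp add: student_process_eq centered_ss_scale flip: sum_distrib_left)
qed

lemma student_process_cong:
  assumes "\<And>i. 1 \<le> i \<Longrightarrow> i \<le> n \<Longrightarrow> y i = z i" "0 \<le> t"
  shows "student_process n 0 y t = student_process n 0 z t"
proof -
  have mean: "sample_mean n y = sample_mean n z"
    using assms by (simp add: sample_mean_def)
  have ss: "centered_ss n y m = centered_ss n z m" if "m \<le> n" for m
    unfolding centered_ss_def mean using assms that by (intro sum.cong) auto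
  have ind: "student_index n y t = student_index n z t"
    unfolding student_index_eq by (intro arg_cong[of _ _ Max]) (auto simp: ss)
  have "(\<Sum>i=1..student_index n z t. y i) = (\<Sum>i=1..student_index n z t. z i)"
    using student_index_props(1)[OF assms(2), of n z] assms by (intro sum.cong) auto
  then show ?thesis
    by (simp add: student_process_eq ind ss)
qed

section \<open>Regularity and measurability of the Student path\<close>

lemma eventually_le_mult_at_right:
  fixes a b t :: real
  assumes "b \<ge> 0"
  shows "eventually (\<lambda>s. a \<le> s * b \<longleftrightarrow> a \<le> t * b) (at_right t)"
proof (cases "a \<le> t * b")
  case True
  have "a \<le> s * b" if "t < s" for s
    using True mult_right_mono[of t s b] that assms by linarith
  then show ?thesis
    using True by (auto simp: eventually_at_filter)
next
  case False
  have "((\<lambda>s. s * b) \<longlongrightarrow> t * b) (at_right t)"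
    by (intro tendsto_intros)
  then have "eventually (\<lambda>s. s * b < a) (at_right t)"
    using False by (intro order_tendstoD(2)) auto
  then show ?thesis
    by (rule eventually_mono) (use False in auto)
qed

text \<open>For \<open>b > 0\<close> and \<open>a = t * b\<close> the comparison holds at
  \<open>t\<close> but fails just before. Because of this jump only some constant truth value is
  claimed on the left, whereas on the right it is the value at \<open>t\<close>.\<close>

lemma eventually_le_mult_at_left:
  fixes a b t :: real
  assumes "b \<ge> 0"
  shows "\<exists>c. eventually (\<lambda>s. a \<le> s * b \<longleftrightarrow> c) (at_left t)"
proof (cases "a < t * b \<or> b = 0")
  case True
  show ?thesis
  proof (cases "b = 0")
    case False
    have "((\<lambda>s. s * b) \<longlongrightarrow> t * b) (at_left t)"
      by (intro tendsto_intros)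
    then have "eventually (\<lambda>s. a < s * b) (at_left t)"
      using True False by (intro order_tendstoD(1)) auto
    then have "eventually (\<lambda>s. a \<le> s * b \<longleftrightarrow> True) (at_left t)"
      by eventually_elim auto
    then show ?thesis ..
  qed auto
next
  case False
  have "\<not> a \<le> s * b" if "s < t" for s
    using False mult_strict_right_mono[of s t b] that assms by linarith
  then have "eventually (\<lambda>s. a \<le> s * b \<longleftrightarrow> False) (at_left t)"
    by (auto simp: eventually_at_filter)
  then show ?thesis ..
qed

text \<open>\<open>student_index\<close> depends on \<open>t\<close> only through
  \<open>n + 1\<close> comparisons of the clock with \<open>t\<close>. Each is locally constant on
  either side of a time, hence so is the path, and no jump has to be located.\<close>

lemma student_path_in_D01: "path (\<lambda>t \<omega>. student_process n \<mu> (z \<omega>) t) \<omega> \<in> D01"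
proof -
  let ?x = "path (\<lambda>t \<omega>. student_process n \<mu> (z \<omega>) t) \<omega>" and ?q = "centered_ss n (z \<omega>)"
  have cong: "student_process n \<mu> (z \<omega>) s = student_process n \<mu> (z \<omega>) t"
    if "\<forall>m\<in>{0..n}. ?q m \<le> s * ?q n \<longleftrightarrow> ?q m \<le> t * ?q n" for s t
  proof -
    have "student_index n (z \<omega>) s = student_index n (z \<omega>) t"
      unfolding student_index_eq using that by (intro arg_cong[of _ _ Max]) auto
    then show ?thesis by (simp add: student_process_eq)
  qed
  have "(?x \<longlongrightarrow> ?x t) (at_right t)" if t: "t \<in> {0..<1}" for t
  proof (rule tendsto_eventually)
    have "eventually (\<lambda>s. \<forall>m\<in>{0..n}. ?q m \<le> s * ?q n \<longleftrightarrow> ?q m \<le> t * ?q n) (at_right t)"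
      by (intro eventually_ball_finite ballI eventually_le_mult_at_right) (auto simp: centered_ss_nonneg)
    moreover have "eventually (\<lambda>s. s \<in> {t<..<1}) (at_right t)"
      using t by (intro eventually_at_right_real) auto
    ultimately show "eventually (\<lambda>s. ?x s = ?x t) (at_right t)"
    proof eventually_elim
      case (elim s)
      then show ?case using t cong[of s t] by (auto simp: path_def)
    qed
  qed
  moreover have "\<exists>l. (?x \<longlongrightarrow> l) (at_left t)" if t: "t \<in> {0<..1}" for t
  proof -
    have "\<forall>m. \<exists>c. eventually (\<lambda>s. ?q m \<le> s * ?q n \<longleftrightarrow> c) (at_left t)"
      by (intro allI eventually_le_mult_at_left) (auto simp: centered_ss_nonneg)
    then obtain c where c: "\<And>m. eventually (\<lambda>s. ?q m \<le> s * ?q n \<longleftrightarrow> c m) (at_left t)"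
      by metis
    have ev: "eventually (\<lambda>s. (\<forall>m\<in>{0..n}. ?q m \<le> s * ?q n \<longleftrightarrow> c m) \<and> s \<in> {0<..<t}) (at_left t)"
      using t by (intro eventually_conj eventually_ball_finite ballI c eventually_at_left_real) auto
    then obtain s0 where s0: "\<forall>m\<in>{0..n}. ?q m \<le> s0 * ?q n \<longleftrightarrow> c m" "s0 \<in> {0<..<t}"
      using eventually_happens'[OF trivial_limit_at_left_real ev] by blast
    have "(?x \<longlongrightarrow> ?x s0) (at_left t)"
    proof (rule tendsto_eventually)
      show "eventually (\<lambda>s. ?x s = ?x s0) (at_left t)"
        using ev
      proof eventually_elim
        case (elim s)
        then show ?case using t s0 cong[of s s0] by (auto simp: path_def)
      qed
    qed
    then show ?thesis ..
  qed
  ultimately show ?thesis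
    by (auto simp: D01_def path_def)
qed

lemma student_process_measurable:
  assumes [measurable]: "\<And>i. i \<in> {1..n} \<Longrightarrow> Y i \<in> borel_measurable M"
    and True: "0 \<le> t"
  shows "(\<lambda>\<omega>. student_process n 0 (\<lambda>i. Y i \<omega>) t) \<in> borel_measurable M"
proof -
  have ss [measurable]: "(\<lambda>\<omega>. centered_ss n (\<lambda>i. Y i \<omega>) m) \<in> borel_measurable M" if "m \<le> n" for m
    unfolding centered_ss_def sample_mean_def using that
    by (intro borel_measurable_sum borel_measurable_power borel_measurable_diff borel_measurable_divide assms) auto
  have [measurable]: "(\<lambda>\<omega>. student_index n (\<lambda>i. Y i \<omega>) t) \<in> measurable M (count_space UNIV)"
  proof -
    have "Measurable.pred M (\<lambda>\<omega>. m \<le> n \<and> centered_ss n (\<lambda>i. Y i \<omega>) m \<le> t * centered_ss n (\<lambda>i. Y i \<omega>) n)" for m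
      by (cases "m \<le> n") auto
    then have "(\<lambda>\<omega>. Max {m. m \<le> n \<and> centered_ss n (\<lambda>i. Y i \<omega>) m \<le> t * centered_ss n (\<lambda>i. Y i \<omega>) n})
        \<in> measurable M (count_space UNIV)"
      by measurable
    then show ?thesis by (simp add: student_index_eq)
  qed
  \<comment> \<open>The random upper summation limit becomes a random 0-1 factor in a sum over a
    fixed range.\<close>
  have "(\<Sum>i=1..student_index n (\<lambda>i. Y i \<omega>) t. Y i \<omega>) =
      (\<Sum>i=1..n. if i \<le> student_index n (\<lambda>i. Y i \<omega>) t then Y i \<omega> else 0)" for \<omega>
    using student_index_props(1)[OF True, of n "\<lambda>i. Y i \<omega>"]
    by (intro sum.mono_neutral_cong_left) auto
  then show ?thesis
    unfolding student_process_eq by simp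
qed

subsection \<open>The ratio condition is necessary\<close>

text \<open>The position of a dominant observation is random, so no single increment would detect
  it; the minimum reacts to a frozen cell anywhere in the grid and is still Lipschitz for the sup
  norm.\<close>

definition min_increment :: "nat \<Rightarrow> (real \<Rightarrow> real) \<Rightarrow> real" where
  "min_increment m x = (MIN k\<in>{..<m}. \<bar>x (real (Suc k) / real m) - x (real k / real m)\<bar>)"

lemma grid_in_unit: "k \<le> m \<Longrightarrow> real k / real m \<in> {0..1}"
  by (auto simp: divide_le_eq)

lemma min_increment_nonneg: "m \<ge> 1 \<Longrightarrow> 0 \<le> min_increment m x"
  unfolding min_increment_def by (subst Min_ge_iff) (auto simp: lessThan_empty_iff)

lemma min_increment_le_0_iff:
  assumes "m \<ge> 1"
  shows "min_increment m x \<le> 0 \<longleftrightarrow> (\<exists>k<m. x (real (Suc k) / real m) = x (real k / real m))"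
  unfolding min_increment_def using assms by (subst Min_le_iff) (auto simp: lessThan_empty_iff)

lemma min_increment_measurable:
  "min_increment m \<in> borel_measurable D01_algebra"
  unfolding min_increment_def
proof (rule borel_measurable_Min)
  fix k assume "k \<in> {..<m}"
  then show "(\<lambda>x. \<bar>x (real (Suc k) / real m) - x (real k / real m)\<bar>) \<in> borel_measurable D01_algebra"
    by (intro borel_measurable_abs borel_measurable_diff measurable_eval_D01 grid_in_unit) auto
qed simp

text \<open>Both paths are compared on the cell where \<open>y\<close> attains its minimum; each of
  the two endpoints contributes an error \<open>c\<close>.\<close>

lemma min_increment_le:
  assumes "m \<ge> 1" "\<And>t. t \<in> {0..1} \<Longrightarrow> \<bar>x t - y t\<bar> \<le> c"
  shows "min_increment m x \<le> min_increment m y + 2 * c"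
proof -
  have "min_increment m y \<in> (\<lambda>k. \<bar>y (real (Suc k) / real m) - y (real k / real m)\<bar>) ` {..<m}"
    unfolding min_increment_def using assms by (intro Min_in) (auto simp: lessThan_empty_iff)
  then obtain k where k: "k < m" "min_increment m y = \<bar>y (real (Suc k) / real m) - y (real k / real m)\<bar>"
    by auto
  have "min_increment m x \<le> \<bar>x (real (Suc k) / real m) - x (real k / real m)\<bar>"
    unfolding min_increment_def using k by (intro Min_le) auto
  also have "\<dots> \<le> min_increment m y + 2 * c"
    using assms(2)[OF grid_in_unit, of k m] assms(2)[OF grid_in_unit, of "Suc k" m] k by auto
  finally show ?thesis .
qed

lemma min_increment_continuous:
  assumes "m \<ge> 1" "x \<in> D01"
  shows "sup_continuous_at (min_increment m) x"
  unfolding sup_continuous_at_def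
proof (intro allI impI)
  fix e :: real assume "e > 0"
  show "\<exists>\<delta>>0. \<forall>y\<in>D01. sup_dist x y < \<delta> \<longrightarrow> \<bar>min_increment m x - min_increment m y\<bar> < e"
  proof (intro exI[of _ "e/2"] conjI ballI impI)
    fix y assume y: "y \<in> D01" "sup_dist x y < e / 2"
    have "\<bar>x t - y t\<bar> \<le> sup_dist x y" "\<bar>y t - x t\<bar> \<le> sup_dist x y" if "t \<in> {0..1}" for t
      using abs_diff_le_sup_dist[OF assms(2) y(1) that] by (auto simp: abs_minus_commute)
    then show "\<bar>min_increment m x - min_increment m y\<bar> < e"
      using min_increment_le[of m x y "sup_dist x y"] min_increment_le[of m y x "sup_dist x y"] assms(1) y(2)
      by auto
  qed (use \<open>e > 0\<close> in auto)
qed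

section \<open>A dominant observation freezes the clock\<close>

lemma centered_ss_eq:
  assumes "n \<ge> 1"
  shows "centered_ss n y n = (\<Sum>i=1..n. (y i)\<^sup>2) - (\<Sum>i=1..n. y i)\<^sup>2 / real n"
proof -
  have "centered_ss n y n = (\<Sum>i=1..n. (y i)\<^sup>2) - 2 * sample_mean n y * (\<Sum>i=1..n. y i) + real n * (sample_mean n y)\<^sup>2"
    by (simp add: centered_ss_def power2_diff sum.distrib sum_subtractf sum_distrib_left mult_ac)
  then show ?thesis
    using assms by (simp add: sample_mean_def power2_eq_square field_simps)
qed

text \<open>A summand carrying a fraction of the total sum of squares freezes the random clock, and hence
  the process, on a time interval whose length is comparable to that fraction.\<close>

lemma student_process_frozen:
  assumes n: "n \<ge> 1" "4 \<le> \<epsilon> * real n" and \<epsilon>: "\<epsilon> > 0" and m: "8 \<le> \<epsilon> * real m"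
    and ratio: "max_ratio n 0 y > \<epsilon>"
  shows "\<exists>k<m. student_process n 0 y (real (Suc k) / real m) = student_process n 0 y (real k / real m)"
proof -
  let ?q = "centered_ss n y" and ?V = "\<Sum>i=1..n. (y i)\<^sup>2"
  have m1: "m \<ge> 1" using m \<epsilon> by (cases m) auto
  show ?thesis
  proof (cases "?q n = 0")
    case True
    \<comment> \<open>All observations coincide and the denominator is 0; by
      \<open>x / 0 = 0\<close> the process vanishes, so every cell is frozen.\<close>
    then have "student_process n 0 y t = 0" for t by (simp add: student_process_eq)
    then show ?thesis using m1 by (intro exI[of _ 0]) auto
  next
    case False
    have q_pos: "?q n > 0"
      using False centered_ss_nonneg[of n y n] by linarith
    have q_le: "?q n \<le> ?V"
      using n by (simp add: centered_ss_eq)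
    have V: "?V > 0" using q_pos q_le by linarith
    then have "\<epsilon> * ?V < (MAX i\<in>{1..n}. (y i)\<^sup>2)"
      using ratio by (simp add: max_ratio_def field_simps)
    moreover have "(MAX i\<in>{1..n}. (y i)\<^sup>2) \<in> (\<lambda>i. (y i)\<^sup>2) ` {1..n}"
      using n by (intro Max_in) auto
    ultimately obtain i where i: "i \<in> {1..n}" "\<epsilon> * ?V < (y i)\<^sup>2" by auto
    \<comment> \<open>The 4 in the bound on \<open>n\<close> makes the squared mean at most
      \<open>\<epsilon> * ?V / 4\<close>. In \<open>y^2 \<le> 2 * (y - mean)^2 + 2 * mean^2\<close>
      the mean then absorbs at most half of \<open>\<epsilon> * ?V\<close>, which leaves a clock
      jump above \<open>\<epsilon> * ?V / 4\<close>.\<close>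
    have "(\<Sum>i=1..n. y i)\<^sup>2 \<le> real n * ?V"
      using Cauchy_Schwarz_ineq_sum[of "\<lambda>_. 1" y "{1..n}"] by simp
    then have "(sample_mean n y)\<^sup>2 \<le> ?V / real n"
      using n by (simp add: sample_mean_def power_divide power2_eq_square field_simps)
    also have "?V / real n \<le> \<epsilon> * ?V / 4"
      using n V \<epsilon> mult_right_mono[OF n(2), of ?V] by (simp add: field_simps)
    finally have mean: "(sample_mean n y)\<^sup>2 \<le> \<epsilon> * ?V / 4" .
    have "(y i)\<^sup>2 \<le> 2 * (y i - sample_mean n y)\<^sup>2 + 2 * (sample_mean n y)\<^sup>2"
    proof -
      have "0 \<le> (y i - 2 * sample_mean n y)\<^sup>2" by simp
      then show ?thesis by (simp add: power2_eq_square algebra_simps)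
    qed
    moreover have "\<epsilon> * ?q n / 4 \<le> \<epsilon> * ?V / 4"
      using q_le \<epsilon> by simp
    moreover have "(y i - sample_mean n y)\<^sup>2 = ?q i - ?q (i - 1)"
      using i(1) unfolding centered_ss_def
      by (cases i) (auto)
    ultimately have gap: "?q i - ?q (i - 1) > \<epsilon> * ?q n / 4"
      using i mean by linarith
    \<comment> \<open>\<open>k / m\<close> is the first grid time at or after the clock value
      reached just before observation \<open>i\<close>. By the 8 in the bound on \<open>m\<close>,
      the jump exceeds \<open>\<epsilon> / 4 \<ge> 2 / m\<close> of the total: enough for the
      rounding and for one full cell.\<close>
    define k where "k = nat \<lceil>real m * ?q (i - 1) / ?q n\<rceil>"
    have "0 \<le> real m * ?q (i - 1) / ?q n"
      using q_pos by (simp add: centered_ss_nonneg)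
    then have k: "real m * ?q (i - 1) / ?q n \<le> real k" "real k < real m * ?q (i - 1) / ?q n + 1"
      unfolding k_def by linarith+
    have lo: "?q (i - 1) \<le> real k / real m * ?q n"
      using k(1) q_pos m1 by (simp add: field_simps)
    have "real m * (\<epsilon> * ?q n / 4) \<ge> 2 * ?q n"
      using mult_right_mono[OF m, of "?q n"] q_pos by (simp add: field_simps)
    moreover have "real m * (?q i - ?q (i - 1)) > real m * (\<epsilon> * ?q n / 4)"
      using gap m1 by (intro mult_strict_left_mono) auto
    moreover have "real k * ?q n < real m * ?q (i - 1) + ?q n"
      using k(2) q_pos by (simp add: field_simps)
    ultimately have hi': "real (Suc k) * ?q n < real m * ?q i"
      by (simp add: algebra_simps)
    then have hi: "real (Suc k) / real m * ?q n < ?q i"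
      using m1 by (simp add: field_simps)
    have "real (Suc k) * ?q n < real m * ?q n"
      using hi' centered_ss_mono[of i n n y] i(1) m1
      by (meson atLeastAtMost_iff less_le_trans mult_left_mono of_nat_0_le_iff)
    then have km: "k < m"
      using q_pos by (simp add: mult_less_cancel_right)
    have "student_index n y t = i - 1"
      if t: "real k / real m \<le> t" "t \<le> real (Suc k) / real m" for t
    proof (rule antisym)
      have t0: "0 \<le> t" using t(1) by (rule order_trans[rotated]) simp
      have "?q (i - 1) \<le> t * ?q n"
        using lo mult_right_mono[OF t(1), of "?q n"] q_pos by linarith
      then show "i - 1 \<le> student_index n y t"
        using i(1) by (intro student_index_props(3) t0) auto
      have "\<not> i \<le> student_index n y t"
      proof
        assume "i \<le> student_index n y t"
        then have "?q i \<le> t * ?q n"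
          using centered_ss_mono[of i] student_index_props(2)[OF t0, of n y] by (meson order_trans)
        then show False
          using hi mult_right_mono[OF t(2), of "?q n"] q_pos by linarith
      qed
      then show "student_index n y t \<le> i - 1" by simp
    qed
    moreover have "real k / real m \<le> real (Suc k) / real m"
      by (simp add: divide_right_mono)
    ultimately show ?thesis
      using km by (intro exI[of _ k]) (simp add: student_process_eq)
  qed
qed

section \<open>From the Wiener increments to the ratio condition\<close>

lemma wiener_increment_null:
  assumes W: "wiener_process N W" and st: "0 \<le> s" "s < t" "t \<le> 1"
  shows "measure N {\<omega> \<in> space N. W t \<omega> = W s \<omega>} = 0"
proof -
  have "distributed N lborel (\<lambda>\<omega>. W t \<omega> - W s \<omega>) (normal_density 0 (sqrt (t - s)))"
    using W st by (auto simp: wiener_process_def)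
  then have "emeasure N ((\<lambda>\<omega>. W t \<omega> - W s \<omega>) -` {0} \<inter> space N) =
      (\<integral>\<^sup>+x. ennreal (normal_density 0 (sqrt (t - s)) x) * indicator {0} x \<partial>lborel)"
    by (rule distributed_emeasure) simp
  also have "\<dots> = (\<integral>\<^sup>+(x::real). 0 \<partial>lborel)"
    using AE_lborel_singleton[of "0::real"] by (intro nn_integral_cong_AE) (auto elim: eventually_mono)
  finally show ?thesis
    by (simp add: measure_def vimage_def Int_def conj_commute)
qed

lemma prob_min_increment_wiener:
  assumes W: "wiener_process N W" and m: "m \<ge> 1"
  shows "measure N {\<omega> \<in> space N. min_increment m (path W \<omega>) \<le> 0} = 0"
proof -
  interpret prob_space N using W by (simp add: wiener_process_def)
  let ?A = "\<lambda>k. {\<omega> \<in> space N. W (real (Suc k) / real m) \<omega> = W (real k / real m) \<omega>}"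
  have rv: "W (real k / real m) \<in> borel_measurable N" if "k \<le> m" for k
    using W that by (auto simp: wiener_process_def simp del: of_nat_Suc divide_le_eq_1 intro!: grid_in_unit)
  have [measurable]: "?A k \<in> sets N" if "k \<in> {..<m}" for k
  proof -
    have [measurable]: "W (real k / real m) \<in> borel_measurable N" "W (real (Suc k) / real m) \<in> borel_measurable N"
      using that by (auto intro!: rv simp del: of_nat_Suc)
    show ?thesis by measurable
  qed
  have "path W \<omega> (real k / real m) = W (real k / real m) \<omega>" if "k \<le> m" for k \<omega>
    using grid_in_unit[OF that] by (simp add: path_def)
  then have "{\<omega> \<in> space N. min_increment m (path W \<omega>) \<le> 0} = (\<Union>k\<in>{..<m}. ?A k)"
    using m by (auto simp: min_increment_le_0_iff simp del: of_nat_Suc)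
  also have "measure N \<dots> \<le> (\<Sum>k\<in>{..<m}. measure N (?A k))"
    by (intro finite_measure_subadditive_finite) (auto simp del: of_nat_Suc)
  also have "\<dots> = 0"
    by (intro sum.neutral ballI wiener_increment_null[OF W]) (auto simp: divide_strict_right_mono divide_le_eq)
  finally show ?thesis by (simp add: measure_le_0_iff)
qed

text \<open>For large \<open>n\<close>, a ratio above \<epsilon> forces
  \<open>min_increment m\<close> of the Student path down to 0. Weak convergence of this functional
  makes that event asymptotically null; the grid size depends on \<epsilon> but not on
  \<open>n\<close>.\<close>

lemma ratio_to_0_if_student_converges:
  fixes Y :: "nat \<Rightarrow> 'a \<Rightarrow> real"
  assumes W: "wiener_process N W"
    and Y: "\<And>i. i \<ge> 1 \<Longrightarrow> Y i \<in> borel_measurable M"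
    and M: "prob_space M"
    and conv: "converges_in_distr_D01 M (\<lambda>n t \<omega>. student_process n 0 (\<lambda>i. Y i \<omega>) t) N W"
  shows "converges_in_prob M (\<lambda>n \<omega>. max_ratio n 0 (\<lambda>i. Y i \<omega>)) 0"
  unfolding converges_in_prob_def
proof (intro allI impI)
  fix \<epsilon> :: real assume \<epsilon>: "\<epsilon> > 0"
  interpret M: prob_space M by fact
  interpret N: prob_space N using W by (simp add: wiener_process_def)
  define m where "m = nat \<lceil>8 / \<epsilon>\<rceil>"
  have "8 / \<epsilon> \<le> real m" unfolding m_def by linarith
  then have m: "8 \<le> \<epsilon> * real m" using \<epsilon> by (simp add: field_simps)
  have m1: "m \<ge> 1" using m \<epsilon> by (cases m) auto
  let ?h = "min_increment m"
  let ?T = "\<lambda>n t \<omega>. student_process n 0 (\<lambda>i. Y i \<omega>) t"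
  have pT: "path (?T n) \<in> measurable M D01_algebra" for n
    using Y by (intro path_measurable student_process_measurable student_path_in_D01) auto
  have hT [measurable]: "(\<lambda>\<omega>. ?h (path (?T n) \<omega>)) \<in> borel_measurable M" for n
    using pT min_increment_measurable by (rule measurable_compose)
  have hW [measurable]: "(\<lambda>\<omega>. ?h (path W \<omega>)) \<in> borel_measurable N"
    using path_wiener_measurable[OF W] min_increment_measurable by (rule measurable_compose)
  have "weak_conv_m (\<lambda>n. distr M borel (\<lambda>\<omega>. ?h (path (?T n) \<omega>))) (distr N borel (\<lambda>\<omega>. ?h (path W \<omega>)))"
    using conv unfolding converges_in_distr_D01_def
    by (elim ballE[of _ _ ?h] impE)
       (auto intro!: AE_I2 min_increment_continuous m1 simp: min_increment_measurable)
  \<comment> \<open>The limit law puts no mass at 0 or below, so 0 is a continuity point of its cdf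
    and weak convergence may be evaluated exactly there.\<close>
  moreover have cdf0: "measure N {\<omega> \<in> space N. ?h (path W \<omega>) \<le> 0} = 0"
    by (rule prob_min_increment_wiener[OF W m1])
  then have "measure (distr N borel (\<lambda>\<omega>. ?h (path W \<omega>))) {0} = 0"
    using min_increment_nonneg[OF m1] by (simp add: measure_distr vimage_def Int_def conj_commute eq_iff)
  then have "isCont (cdf (distr N borel (\<lambda>\<omega>. ?h (path W \<omega>)))) 0"
    using hW by (subst finite_borel_measure.isCont_cdf)
      (auto intro!: real_distribution.finite_borel_measure_M N.real_distribution_distr)
  ultimately have "(\<lambda>n. cdf (distr M borel (\<lambda>\<omega>. ?h (path (?T n) \<omega>))) 0)
      \<longlonglongrightarrow> cdf (distr N borel (\<lambda>\<omega>. ?h (path W \<omega>))) 0"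
    by (simp add: weak_conv_m_def weak_conv_def)
  then have lim: "(\<lambda>n. measure M {\<omega> \<in> space M. ?h (path (?T n) \<omega>) \<le> 0}) \<longlonglongrightarrow> 0"
    using cdf0 by (simp add: cdf_def measure_distr vimage_def Int_def conj_commute)
  show "(\<lambda>n. measure M {\<omega> \<in> space M. \<bar>max_ratio n 0 (\<lambda>i. Y i \<omega>) - 0\<bar> > \<epsilon>}) \<longlonglongrightarrow> 0"
  proof (rule tendsto_sandwich[OF _ _ tendsto_const lim])
    have "eventually (\<lambda>n. n \<ge> 1 \<and> real n \<ge> 4 / \<epsilon>) sequentially"
      by (intro eventually_conj eventually_ge_at_top filterlim_at_top[THEN iffD1, rule_format] filterlim_real_sequentially)
    then show "eventually (\<lambda>n. measure M {\<omega> \<in> space M. \<bar>max_ratio n 0 (\<lambda>i. Y i \<omega>) - 0\<bar> > \<epsilon>}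
       \<le> measure M {\<omega> \<in> space M. ?h (path (?T n) \<omega>) \<le> 0}) sequentially"
    proof eventually_elim
      case (elim n)
      have nonneg: "max_ratio n 0 y \<ge> 0" for y
      proof -
        have "(y 1)\<^sup>2 \<le> (MAX i\<in>{1..n}. (y i)\<^sup>2)"
          using elim by (intro Max_ge) auto
        then have "0 \<le> (MAX i\<in>{1..n}. (y i)\<^sup>2)"
          using zero_le_power2 order_trans by blast
        then show ?thesis by (auto simp: max_ratio_def sum_nonneg)
      qed
      have "?h (path (?T n) \<omega>) \<le> 0" if "max_ratio n 0 (\<lambda>i. Y i \<omega>) > \<epsilon>" for \<omega>
      proof -
        have "path (?T n) \<omega> (real k / real m) = ?T n (real k / real m) \<omega>" if "k \<le> m" for k
          using grid_in_unit[OF that] by (simp add: path_def)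
        moreover have "4 \<le> \<epsilon> * real n" using elim \<epsilon> by (simp add: field_simps)
        ultimately show ?thesis
          using student_process_frozen[OF _ _ \<epsilon> m that] elim m1
          by (auto simp: min_increment_le_0_iff simp del: of_nat_Suc)
      qed
      then show ?case
        using nonneg by (intro M.finite_measure_mono) auto
    qed
  qed auto
qed

subsection \<open>Approximation of the Student process by block sums\<close>

text \<open>A deterministic stand-in for \<open>student_index\<close>. It uses uncentred squares,
  which sign changes leave alone, so the blocks are the same for all sign vectors. The level
  \<open>j / m\<close> presupposes a total sum of squares of 1.\<close>

definition block_end :: "nat \<Rightarrow> (nat \<Rightarrow> real) \<Rightarrow> nat \<Rightarrow> nat \<Rightarrow> nat" where
  "block_end n z m j = Max {k \<in> {0..n}. (\<Sum>i=1..k. (z i)\<^sup>2) \<le> real j / real m}"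

lemma block_end_props:
  shows "block_end n z m j \<le> n"
    and "(\<Sum>i=1..block_end n z m j. (z i)\<^sup>2) \<le> real j / real m"
    and "k \<le> n \<Longrightarrow> (\<Sum>i=1..k. (z i)\<^sup>2) \<le> real j / real m \<Longrightarrow> k \<le> block_end n z m j"
proof -
  let ?S = "{k \<in> {0..n}. (\<Sum>i=1..k. (z i)\<^sup>2) \<le> real j / real m}"
  have "0 \<in> ?S" by simp
  then have "Max ?S \<in> ?S" by (intro Max_in) auto
  then show "block_end n z m j \<le> n" "(\<Sum>i=1..block_end n z m j. (z i)\<^sup>2) \<le> real j / real m"
    by (auto simp: block_end_def)
  show "k \<le> block_end n z m j" if "k \<le> n" "(\<Sum>i=1..k. (z i)\<^sup>2) \<le> real j / real m"
    unfolding block_end_def using that by (intro Max_ge) auto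
qed

lemma block_end_mono: "i \<le> j \<Longrightarrow> block_end n z m i \<le> block_end n z m j"
  by (rule block_end_props(3)[OF block_end_props(1)], rule order_trans[OF block_end_props(2)])
     (simp add: divide_right_mono)

lemma block_end_last: "m \<ge> 1 \<Longrightarrow> (\<Sum>i=1..n. (z i)\<^sup>2) = 1 \<Longrightarrow> block_end n z m m = n"
  by (rule antisym[OF block_end_props(1) block_end_props(3)]) auto

text \<open>If the leading observations vanish, \<open>block_end\<close> at level 0 is positive and
  the first block does not start at index 1; nothing is lost, as the skipped terms are 0.\<close>

lemma sum_before_first_block:
  assumes "k \<le> block_end n z m 0"
  shows "(\<Sum>i=1..k. z i) = 0"
proof -
  have "(\<Sum>i=1..k. (z i)\<^sup>2) \<le> (\<Sum>i=1..block_end n z m 0. (z i)\<^sup>2)"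
    using assms by (intro sum_mono2) auto
  also have "\<dots> \<le> 0" using block_end_props(2)[where n=n and z=z and m=m and j=0] by simp
  finally have "(\<Sum>i=1..k. (z i)\<^sup>2) = 0" by (rule antisym) (simp add: sum_nonneg)
  then show ?thesis by (subst (asm) sum_nonneg_eq_0_iff) auto
qed

text \<open>Each block crossed adds at most \<eta>. With \<open>j = m\<close> this bounds all
  partial sums by \<open>m * \<eta>\<close>, independently of \<open>n\<close>, which makes the
  sample mean of order \<open>1 / n\<close>.\<close>

lemma partial_sums_bounded:
  assumes osc: "\<And>j k. j < m \<Longrightarrow> block_end n z m j \<le> k \<Longrightarrow> k \<le> block_end n z m (Suc j) \<Longrightarrow>
      \<bar>(\<Sum>i=1..k. z i) - (\<Sum>i=1..block_end n z m j. z i)\<bar> \<le> \<eta>"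
    and "j \<le> m" "k \<le> block_end n z m j"
  shows "\<bar>\<Sum>i=1..k. z i\<bar> \<le> real j * \<eta>"
  using assms(2,3)
proof (induction j arbitrary: k)
  case 0
  then show ?case using sum_before_first_block by simp
next
  case (Suc j)
  have \<eta>: "0 \<le> \<eta>"
    using osc[of j "block_end n z m j"] Suc.prems block_end_mono[of j "Suc j"] by force
  show ?case
  proof (cases "k \<le> block_end n z m j")
    case True
    then show ?thesis using Suc.IH[of k] Suc.prems \<eta> by (simp add: algebra_simps)
  next
    case False
    then show ?thesis
      using Suc.IH[of "block_end n z m j"] osc[of j k] Suc.prems unfolding of_nat_Suc distrib_right by simp
  qed
qed

text \<open>The difference is \<open>k * M^2 - 2 * M * S\<close> with a mean \<open>M\<close> of
  size at most \<open>C / n\<close> and a partial sum \<open>S\<close> of size at most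
  \<open>C\<close>: the first term gives \<open>C^2 / n\<close>, the second twice that.\<close>

lemma centered_ss_approx:
  assumes n: "n \<ge> 1" and C: "\<And>k. k \<le> n \<Longrightarrow> \<bar>\<Sum>i=1..k. z i\<bar> \<le> C" and k: "k \<le> n"
  shows "\<bar>centered_ss n z k - (\<Sum>i=1..k. (z i)\<^sup>2)\<bar> \<le> 3 * C\<^sup>2 / real n"
proof -
  let ?M = "sample_mean n z" and ?S = "\<lambda>k. \<Sum>i=1..k. z i"
  have C0: "C \<ge> 0" using C[of 0] by simp
  have M: "\<bar>?M\<bar> \<le> C / real n"
    using C[of n] n by (simp add: sample_mean_def divide_right_mono)
  have M2: "?M\<^sup>2 \<le> (C / real n)\<^sup>2"
    using M C0 by (simp only: power2_le_iff_abs_le divide_nonneg_nonneg of_nat_0_le_iff)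
  have "centered_ss n z k - (\<Sum>i=1..k. (z i)\<^sup>2) = real k * ?M\<^sup>2 - 2 * (?M * ?S k)"
    by (simp add: centered_ss_def power2_diff sum.distrib sum_subtractf sum_distrib_left sum_distrib_right mult_ac)
  also have "\<bar>\<dots>\<bar> \<le> real k * ?M\<^sup>2 + 2 * (\<bar>?M\<bar> * \<bar>?S k\<bar>)"
    using abs_triangle_ineq4[of "real k * ?M\<^sup>2" "2 * (?M * ?S k)"] by (simp add: abs_mult)
  also have "\<dots> \<le> real n * (C / real n)\<^sup>2 + 2 * (C / real n * C)"
  proof (rule add_mono)
    show "real k * ?M\<^sup>2 \<le> real n * (C / real n)\<^sup>2"
      by (rule mult_mono) (use M2 k in simp_all)
    have "\<bar>?M\<bar> * \<bar>?S k\<bar> \<le> C / real n * C"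
      by (rule mult_mono[OF M C[OF k]]) (use C0 in simp_all)
    then show "2 * (\<bar>?M\<bar> * \<bar>?S k\<bar>) \<le> 2 * (C / real n * C)" by simp
  qed
  also have "\<dots> = 3 * C\<^sup>2 / real n"
    using n by (simp add: power2_eq_square field_simps)
  finally show ?thesis .
qed

text \<open>Centring moves the clock at an index by at most \<open>3 * C^2 / n\<close> and its total
  by at most \<open>C^2 / n\<close>; the 4 in \<open>large\<close> keeps both together within one
  grid step \<open>1 / m\<close>. Hence one level is lost below, and one above in addition to the
  rounding of \<open>t * m\<close>.\<close>

lemma student_index_block:
  assumes n: "n \<ge> 1" and m: "m \<ge> 1" and V: "(\<Sum>i=1..n. (z i)\<^sup>2) = 1"
    and C: "\<And>k. k \<le> n \<Longrightarrow> \<bar>\<Sum>i=1..k. z i\<bar> \<le> C"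
    and large: "4 * C\<^sup>2 * real m \<le> real n"
    and t: "0 \<le> t" "t \<le> 1" and j: "real j \<le> t * real m" "t * real m < real j + 1"
  shows "student_index n z t \<le> block_end n z m (j + 2)"
    and "j = Suc i \<Longrightarrow> block_end n z m i \<le> student_index n z t"
proof -
  let ?K = "student_index n z t" and ?q = "centered_ss n z" and ?V = "\<lambda>k. \<Sum>i=1..k. (z i)\<^sup>2"
  have near: "\<bar>?q k - ?V k\<bar> \<le> 3 * C\<^sup>2 / real n" if "k \<le> n" for k
    by (rule centered_ss_approx[OF n C that])
  have large': "4 * (C\<^sup>2 / real n) \<le> 1 / real m"
    using large n m by (simp add: field_simps)
  have C2: "0 \<le> C\<^sup>2 / real n" by simp
  have qn: "?q n \<le> 1" "1 - C\<^sup>2 / real n \<le> ?q n"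
  proof -
    have "?q n = 1 - (\<Sum>i=1..n. z i)\<^sup>2 / real n"
      using n V by (simp add: centered_ss_eq)
    moreover have "(\<Sum>i=1..n. z i)\<^sup>2 \<le> C\<^sup>2"
      using C[of n] by (simp add: power2_le_iff_abs_le)
    ultimately show "?q n \<le> 1" "1 - C\<^sup>2 / real n \<le> ?q n"
      by (auto simp: divide_right_mono)
  qed
  have t_lo: "real j / real m \<le> t" and t_hi: "t \<le> (real j + 1) / real m"
    using j m by (auto simp: field_simps)
  show "?K \<le> block_end n z m (j + 2)"
  proof (rule block_end_props(3))
    show K: "?K \<le> n" using t by (simp add: student_index_props)
    have "?V ?K \<le> ?q ?K + 3 * C\<^sup>2 / real n" using near[OF K] by linarith
    also have "?q ?K \<le> t * ?q n" using t by (simp add: student_index_props)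
    also have "t * ?q n \<le> t * 1" using t qn by (intro mult_left_mono) auto
    also have "t * 1 + 3 * C\<^sup>2 / real n \<le> (real j + 1) / real m + 1 / real m"
      using t_hi large' C2 by linarith
    also have "\<dots> = real (j + 2) / real m" by (simp add: add_divide_distrib)
    finally show "?V ?K \<le> real (j + 2) / real m" by simp
  qed
  show "block_end n z m i \<le> ?K" if ji: "j = Suc i"
  proof (rule ccontr)
    let ?b = "block_end n z m i"
    assume "\<not> ?b \<le> ?K"
    then have "?q ?b > t * ?q n"
      using student_index_props(3)[OF t(1) block_end_props(1)] by force
    moreover have "t * ?q n \<ge> t - C\<^sup>2 / real n"
    proof -
      have "t * ?q n \<ge> t * (1 - C\<^sup>2 / real n)"
        using t qn by (intro mult_left_mono) auto
      moreover have "t * (C\<^sup>2 / real n) \<le> 1 * (C\<^sup>2 / real n)"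
        using t C2 by (intro mult_right_mono) auto
      ultimately show ?thesis by (simp add: algebra_simps)
    qed
    moreover have "?q ?b \<le> real i / real m + 3 * C\<^sup>2 / real n"
      using near[OF block_end_props(1)[of n z m i]] block_end_props(2)[where n=n and z=z and m=m and j=i] by linarith
    moreover have "real i / real m + 1 / real m \<le> t"
      using t_lo ji by (simp add: add_divide_distrib add.commute)
    ultimately show False using large' C2 by (simp add: field_simps)
  qed
qed

text \<open>The error consists of \<open>2 * \<eta>\<close>, because the random index is at most two
  blocks away from the deterministic one, and \<eta> for the normalising factor. The three
  \<open>large\<close> conditions serve, in this order, the index, the positivity of the centred sum
  of squares, and the closeness of that factor to 1.\<close>

lemma student_process_near_block_sums:
  assumes n: "n \<ge> 2" and m: "m \<ge> 1" and V: "(\<Sum>i=1..n. (z i)\<^sup>2) = 1"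
    and osc: "\<And>j k. j < m \<Longrightarrow> block_end n z m j \<le> k \<Longrightarrow> k \<le> block_end n z m (Suc j) \<Longrightarrow>
      \<bar>(\<Sum>i=1..k. z i) - (\<Sum>i=1..block_end n z m j. z i)\<bar> \<le> \<eta>"
    and C_def: "C = real m * \<eta>"
    and large: "4 * C\<^sup>2 * real m \<le> real n" "C\<^sup>2 < real n" "C * (C\<^sup>2 + 1) \<le> \<eta> * (real n - C\<^sup>2)"
    and t: "0 \<le> t" "t \<le> 1"
  shows "\<bar>student_process n 0 z t - (\<Sum>i=1..block_end n z m (nat \<lfloor>t * real m\<rfloor>). z i)\<bar> \<le> 3 * \<eta>"
proof -
  let ?K = "student_index n z t" and ?S = "\<lambda>k. \<Sum>i=1..k. z i" and ?b = "block_end n z m"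
  define j where "j = nat \<lfloor>t * real m\<rfloor>"
  have tm: "0 \<le> t * real m" using t by simp
  then have j: "real j \<le> t * real m" "t * real m < real j + 1"
    unfolding j_def by linarith+
  have "real j \<le> real m"
    using j t mult_right_mono[of t 1 "real m"] by simp
  then have jm: "j \<le> m" by simp
  have last: "?b m = n" by (rule block_end_last[OF m V])
  have C: "\<bar>?S k\<bar> \<le> C" if "k \<le> n" for k
    unfolding C_def by (rule partial_sums_bounded[OF osc order_refl]) (simp_all add: last that)
  have C0: "C \<ge> 0" using C[of 0] by simp
  have K: "?K \<le> n" using t by (simp add: student_index_props)
  have n1: "n \<ge> 1" using n by simp
  note idx = student_index_block[OF n1 m V C large(1) t j]
  have \<eta>: "0 \<le> \<eta>"
    using osc[of 0 "?b 0"] m block_end_mono[of 0 "Suc 0"] by force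
  have near: "\<bar>?S ?K - ?S (?b j)\<bar> \<le> 2 * \<eta>"
  proof (cases "?K \<le> ?b j")
    case True
    show ?thesis
    proof (cases j)
      case 0
      then show ?thesis using True sum_before_first_block[of _ n z m] \<eta> by simp
    next
      case (Suc i)
      then have i: "i < m" using jm by simp
      have "\<bar>?S ?K - ?S (?b i)\<bar> \<le> \<eta>"
        by (rule osc[OF i idx(2)[OF _ Suc]]) (use True Suc in simp_all)
      moreover have "\<bar>?S (?b j) - ?S (?b i)\<bar> \<le> \<eta>"
        unfolding Suc by (rule osc[OF i]) (simp_all add: block_end_mono)
      ultimately show ?thesis by linarith
    qed
  next
    case False
    \<comment> \<open>\<open>block_end\<close> at level \<open>m\<close> is \<open>n\<close>, so an
      index beyond the current block excludes \<open>j = m\<close>. The same argument below keeps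
      \<open>Suc j\<close> in range.\<close>
    then have "j < m" using K last jm by (cases "j = m") auto
    show ?thesis
    proof (cases "?K \<le> ?b (Suc j)")
      case True
      have "\<bar>?S ?K - ?S (?b j)\<bar> \<le> \<eta>"
        by (rule osc[OF \<open>j < m\<close> _ True]) (use False in simp)
      then show ?thesis using \<eta> by linarith
    next
      case gt: False
      then have "Suc j < m" using K last \<open>j < m\<close> by (cases "Suc j = m") auto
      then have "\<bar>?S ?K - ?S (?b (Suc j))\<bar> \<le> \<eta>"
        by (rule osc) (use gt idx(1) in simp_all)
      moreover have "\<bar>?S (?b (Suc j)) - ?S (?b j)\<bar> \<le> \<eta>"
        by (rule osc[OF \<open>j < m\<close>]) (simp_all add: block_end_mono)
      ultimately show ?thesis by linarith
    qed
  qed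
  \<comment> \<open>\<open>c\<close> is the factor by which studentisation changes the partial sum.
    Its square is \<open>(n - 1) / (n - S^2)\<close> with \<open>S\<close> the sum of all
    \<open>n\<close> terms.\<close>
  define c where "c = 1 / (sqrt (real n) * sqrt (centered_ss n z n / (real n - 1)))"
  have T: "student_process n 0 z t = c * ?S ?K"
    by (simp add: student_process_eq c_def)
  have Sn: "(?S n)\<^sup>2 \<le> C\<^sup>2" using C[of n] C0 by (simp add: power2_le_iff_abs_le)
  have q: "real n * centered_ss n z n = real n - (?S n)\<^sup>2"
    using n V by (simp add: centered_ss_eq field_simps)
  have q_pos: "centered_ss n z n > 0"
  proof (rule ccontr)
    assume "\<not> ?thesis"
    then have "real n * centered_ss n z n \<le> 0" by (simp add: mult_nonneg_nonpos)
    then show False using q Sn large(2) by linarith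
  qed
  have c0: "c \<ge> 0" using q_pos n by (simp add: c_def)
  have "c\<^sup>2 = (real n - 1) / (real n * centered_ss n z n)"
    using q_pos n by (simp add: c_def power_divide power_mult_distrib field_simps)
  then have c2: "c\<^sup>2 - 1 = ((?S n)\<^sup>2 - 1) / (real n - (?S n)\<^sup>2)"
    using q large(2) Sn by (simp add: field_simps)
  \<comment> \<open>As \<open>c + 1 \<ge> 1\<close>, the distance of \<open>c\<close> from 1 is at
    most that of \<open>c^2\<close>, so no square root has to be expanded.\<close>
  have "\<bar>c - 1\<bar> \<le> \<bar>c - 1\<bar> * (c + 1)"
    using c0 mult_left_mono[of 1 "c + 1" "\<bar>c - 1\<bar>"] by simp
  also have "\<dots> = \<bar>c\<^sup>2 - 1\<bar>"
    using c0 by (simp add: power2_eq_square square_diff_one_factored abs_mult)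
  also have "\<dots> = \<bar>(?S n)\<^sup>2 - 1\<bar> / (real n - (?S n)\<^sup>2)"
    using Sn large(2) by (simp add: c2)
  also have "\<dots> \<le> (C\<^sup>2 + 1) / (real n - C\<^sup>2)"
    using Sn large(2) by (intro frac_le) (auto simp: abs_le_iff)
  finally have c1: "\<bar>c - 1\<bar> \<le> (C\<^sup>2 + 1) / (real n - C\<^sup>2)" .
  have "\<bar>c - 1\<bar> * \<bar>?S ?K\<bar> \<le> (C\<^sup>2 + 1) / (real n - C\<^sup>2) * C"
    by (rule mult_mono[OF c1 C[OF K]]) (use large(2) in simp_all)
  also have "\<dots> \<le> \<eta>"
    using large(2,3) by (simp add: divide_le_eq mult.commute)
  finally have "\<bar>c * ?S ?K - ?S ?K\<bar> \<le> \<eta>"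
    by (simp add: abs_mult[symmetric] left_diff_distrib)
  then show ?thesis
    using near unfolding T j_def by linarith
qed

subsection \<open>Random signs\<close>

text \<open>Coordinates outside \<open>A\<close> have the default value 0. For finite
  \<open>A\<close> the support is finite, so averaging over the signs is a finite sum.\<close>

definition signs :: "nat set \<Rightarrow> (nat \<Rightarrow> real) pmf" where
  "signs A = Pi_pmf A 0 (\<lambda>_. pmf_of_set {-1, 1})"

lemma prob_signs_insert:
  assumes "finite A" "x \<notin> A"
  shows "measure_pmf.prob (signs (insert x A)) {e. P e} =
    (measure_pmf.prob (signs A) {e. P (e(x := 1))} + measure_pmf.prob (signs A) {e. P (e(x := -1))}) / 2"
proof -
  have "emeasure (signs (insert x A)) {e. P e} =
      (\<integral>\<^sup>+s. emeasure (map_pmf (\<lambda>e. e(x := s)) (signs A)) {e. P e} \<partial>pmf_of_set {-1, 1::real})"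
    by (simp add: signs_def Pi_pmf_insert'[OF assms] map_pmf_def[symmetric] del: emeasure_map_pmf)
  also have "\<dots> = (emeasure (signs A) {e. P (e(x := 1))} + emeasure (signs A) {e. P (e(x := -1))}) / 2"
    by (simp add: nn_integral_pmf_of_set vimage_def add.commute)
  finally show ?thesis
    by (simp add: measure_pmf.emeasure_eq_measure ennreal_plus[symmetric] divide_ennreal
        ennreal_numeral[symmetric] del: ennreal_plus ennreal_numeral)
qed

text \<open>A backward induction on \<open>p\<close> in place of optional stopping; \<open>s\<close>
  is the current value of the walk. With \<open>V\<close> the sum of squares, the numerator
  dominates the fourth moment of the end point, since the fourth moment of the sum itself is at most
  \<open>3 * V^2\<close>. Averaging over the next sign loses exactly \<open>2 * a^4\<close>.\<close>

lemma prob_signs_maximal: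
  assumes "finite A" "{p<..q} \<subseteq> A" "p \<le> q" "\<eta> > 0"
  shows "measure_pmf.prob (signs A) {e. \<exists>k\<in>{p..q}. \<eta> \<le> \<bar>s + (\<Sum>i\<in>{p<..k}. e i * a i)\<bar>}
    \<le> (s^4 + 6 * s\<^sup>2 * (\<Sum>i\<in>{p<..q}. (a i)\<^sup>2) + 3 * (\<Sum>i\<in>{p<..q}. (a i)\<^sup>2)\<^sup>2) / \<eta>^4"
  using assms(3,1,2)
proof (induction p arbitrary: A s rule: inc_induct)
  case base
  show ?case
  proof (cases "\<eta> \<le> \<bar>s\<bar>")
    case True
    then have "\<eta>^4 \<le> \<bar>s\<bar>^4" using assms(4) by (intro power_mono) auto
    then show ?thesis using True assms(4) by (simp add: power_abs)
  qed simp
next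
  case (step p)
  let ?V = "\<Sum>i\<in>{p<..q}. (a i)\<^sup>2" and ?V' = "\<Sum>i\<in>{Suc p<..q}. (a i)\<^sup>2"
  have V': "0 \<le> ?V'" by (simp add: sum_nonneg)
  have ins: "{p<..k} = insert (Suc p) {Suc p<..k}" if "Suc p \<le> k" for k
    using that by auto
  have V: "?V = (a (Suc p))\<^sup>2 + ?V'" using step.hyps by (simp add: ins)
  show ?case
  proof (cases "\<eta> \<le> \<bar>s\<bar>")
    case True
    then have "\<eta>^4 \<le> \<bar>s\<bar>^4" using assms(4) by (intro power_mono) auto
    moreover have "0 \<le> 6 * s\<^sup>2 * ?V + 3 * ?V\<^sup>2"
      by (intro add_nonneg_nonneg mult_nonneg_nonneg sum_nonneg) auto
    ultimately have "1 \<le> (s^4 + 6 * s\<^sup>2 * ?V + 3 * ?V\<^sup>2) / \<eta>^4"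
      using assms(4) by (simp add: power_abs)
    then show ?thesis using measure_pmf.prob_le_1 order_trans by blast
  next
    case False
    let ?x = "Suc p" and ?B = "A - {Suc p}"
    have A: "A = insert ?x ?B" using step.prems step.hyps by auto
    let ?E = "\<lambda>s. measure_pmf.prob (signs ?B) {e. \<exists>k\<in>{Suc p..q}. \<eta> \<le> \<bar>s + (\<Sum>i\<in>{Suc p<..k}. e i * a i)\<bar>}"
    let ?G = "\<lambda>s. s^4 + 6 * s\<^sup>2 * ?V' + 3 * ?V'\<^sup>2"
    have IH: "?E s \<le> ?G s / \<eta>^4" for s
      using step.prems step.hyps by (intro step.IH) auto
    \<comment> \<open>As \<open>s\<close> is below the level, \<open>k = p\<close> cannot trigger
      the event; the walk restarts at \<open>Suc p\<close> from
      \<open>s + c * a (Suc p)\<close>.\<close>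
    have ev: "(\<exists>k\<in>{p..q}. \<eta> \<le> \<bar>s + (\<Sum>i\<in>{p<..k}. (e(?x := c)) i * a i)\<bar>) \<longleftrightarrow>
        (\<exists>k\<in>{Suc p..q}. \<eta> \<le> \<bar>(s + c * a ?x) + (\<Sum>i\<in>{Suc p<..k}. e i * a i)\<bar>)" for e :: "nat \<Rightarrow> real" and c
    proof -
      have "s + (\<Sum>i\<in>{p<..k}. (e(?x := c)) i * a i) = (s + c * a ?x) + (\<Sum>i\<in>{Suc p<..k}. e i * a i)"
        if "Suc p \<le> k" for k
        using that by (auto simp: ins intro!: sum.cong)
      moreover have "{p..q} = insert p {Suc p..q}" using step.hyps by auto
      ultimately show ?thesis using False by (auto simp: add.assoc)
    qed
    have "measure_pmf.prob (signs A) {e. \<exists>k\<in>{p..q}. \<eta> \<le> \<bar>s + (\<Sum>i\<in>{p<..k}. e i * a i)\<bar>} =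
        (?E (s + 1 * a ?x) + ?E (s + (-1) * a ?x)) / 2"
      using prob_signs_insert[of ?B ?x "\<lambda>e. \<exists>k\<in>{p..q}. \<eta> \<le> \<bar>s + (\<Sum>i\<in>{p<..k}. e i * a i)\<bar>"] step.prems(1)
      unfolding A[symmetric] ev by simp
    also have "\<dots> \<le> (?G (s + 1 * a ?x) / \<eta>^4 + ?G (s + (-1) * a ?x) / \<eta>^4) / 2"
      by (intro divide_right_mono add_mono IH) auto
    also have "\<dots> = ((?G (s + a ?x) + ?G (s - a ?x)) / 2) / \<eta>^4"
      by (simp add: add_divide_distrib)
    also have "\<dots> \<le> (s^4 + 6 * s\<^sup>2 * ?V + 3 * ?V\<^sup>2) / \<eta>^4"
    proof (intro divide_right_mono)
      have "(?G (s + a ?x) + ?G (s - a ?x)) / 2 + 2 * (a ?x)^4 = s^4 + 6 * s\<^sup>2 * ?V + 3 * ?V\<^sup>2"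
        unfolding V by (simp add: power2_eq_square power4_eq_xxxx field_simps)
      moreover have "0 \<le> (a ?x)^4" by simp
      ultimately show "(?G (s + a ?x) + ?G (s - a ?x)) / 2 \<le> s^4 + 6 * s\<^sup>2 * ?V + 3 * ?V\<^sup>2"
        by linarith
    qed simp
    finally show ?thesis .
  qed
qed

subsection \<open>Joint convergence of independent coordinates\<close>

text \<open>Open subsets of m-dimensional space, represented within
  \<open>nat \<Rightarrow> real\<close> so that \<open>m\<close> may remain a variable; membership
  depends on the first \<open>m\<close> coordinates alone.\<close>

definition coord_open :: "nat \<Rightarrow> (nat \<Rightarrow> real) set \<Rightarrow> bool" where
  "coord_open m G \<longleftrightarrow> (\<forall>v\<in>G. \<exists>\<epsilon>>0. \<forall>w. (\<forall>i<m. \<bar>w i - v i\<bar> < \<epsilon>) \<longrightarrow> w \<in> G)"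

lemma coord_openD:
  assumes "coord_open m G" "v \<in> G"
  obtains \<epsilon> where "\<epsilon> > 0" "\<And>w. (\<And>i. i < m \<Longrightarrow> \<bar>w i - v i\<bar> < \<epsilon>) \<Longrightarrow> w \<in> G"
  using assms unfolding coord_open_def by blast

lemma coord_open_cong:
  assumes "coord_open m G" "\<And>i. i < m \<Longrightarrow> v i = w i"
  shows "v \<in> G \<longleftrightarrow> w \<in> G"
proof -
  have "w \<in> G" if "v \<in> G" "\<And>i. i < m \<Longrightarrow> v i = w i" for v w
    by (rule coord_openD[OF assms(1) that(1)]) (use that(2) in auto)
  then show ?thesis using assms(2) by metis
qed

lemma coord_open_imp_open:
  assumes "coord_open m G"
  shows "open G"
proof (subst open_subopen, intro ballI)
  fix v assume "v \<in> G"
  then obtain \<epsilon> where \<epsilon>: "\<epsilon> > 0" "\<And>w. (\<And>i. i < m \<Longrightarrow> \<bar>w i - v i\<bar> < \<epsilon>) \<Longrightarrow> w \<in> G"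
    by (rule coord_openD[OF assms]) blast
  have "open {w. \<forall>i\<in>{..<m}. w i \<in> ball (v i) \<epsilon>}"
    using product_topology_basis'[of "{..<m}" "\<lambda>i. ball (v i) \<epsilon>" "\<lambda>i. i"] by simp
  moreover have "{w. \<forall>i\<in>{..<m}. w i \<in> ball (v i) \<epsilon>} \<subseteq> G"
    using \<epsilon>(2) by (auto simp: dist_real_def abs_minus_commute)
  ultimately show "\<exists>T. open T \<and> v \<in> T \<and> T \<subseteq> G"
    using \<epsilon>(1) by (intro exI[of _ "{w. \<forall>i\<in>{..<m}. w i \<in> ball (v i) \<epsilon>}"]) auto
qed

lemma coord_open_sets:
  assumes G: "coord_open m G" and X: "\<And>i. i < m \<Longrightarrow> X i \<in> borel_measurable M"
  shows "{\<omega> \<in> space M. (\<lambda>i. X i \<omega>) \<in> G} \<in> sets M"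
proof -
  \<comment> \<open>Measurability of \<open>X i\<close> is available for \<open>i < m\<close> only.
    The other coordinates are set to 0, which membership in \<open>G\<close> cannot notice.\<close>
  let ?X = "\<lambda>\<omega> i. if i < m then X i \<omega> else 0"
  have "?X \<in> borel_measurable M"
  proof (rule measurable_coordinatewise_then_product)
    show "(\<lambda>\<omega>. ?X \<omega> i) \<in> borel_measurable M" for i
      using X by (cases "i < m") auto
  qed
  then have "?X -` G \<inter> space M \<in> sets M"
    using coord_open_imp_open[OF G] by (intro measurable_sets[of _ _ borel]) auto
  moreover have "?X -` G \<inter> space M = {\<omega> \<in> space M. (\<lambda>i. X i \<omega>) \<in> G}"
    using coord_open_cong[OF G, of "?X _" "\<lambda>i. X i _"] by auto
  ultimately show ?thesis by simp
qed

text \<open>Independence and the marginal laws determine the joint law of the first \<open>m\<close>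
  coordinates, which is all that \<open>G\<close> sees. This permits replacing the variables by a
  coupling.\<close>

lemma coord_open_measure_eq:
  assumes P: "prob_space P" and Q: "prob_space Q"
    and G: "coord_open m G" and m: "m \<ge> 1"
    and X: "prob_space.indep_vars P (\<lambda>_. borel) X {..<m}"
    and Y: "prob_space.indep_vars Q (\<lambda>_. borel) Y {..<m}"
    and law: "\<And>i. i < m \<Longrightarrow> distr P borel (X i) = distr Q borel (Y i)"
  shows "measure P {\<omega> \<in> space P. (\<lambda>i. X i \<omega>) \<in> G} = measure Q {\<omega> \<in> space Q. (\<lambda>i. Y i \<omega>) \<in> G}"
proof -
  interpret P: prob_space P by fact
  interpret Q: prob_space Q by fact
  let ?\<Pi> = "\<Pi>\<^sub>M i\<in>{..<m}. (borel :: real measure)"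
  have rvX [measurable]: "X i \<in> borel_measurable P" if "i \<in> {..<m}" for i
    using X that by (auto simp: P.indep_vars_def)
  have rvY [measurable]: "Y i \<in> borel_measurable Q" if "i \<in> {..<m}" for i
    using Y that by (auto simp: Q.indep_vars_def)
  have ne: "{..<m} \<noteq> {}" using m by (auto simp: lessThan_empty_iff)
  have "distr P ?\<Pi> (\<lambda>\<omega>. \<lambda>i\<in>{..<m}. X i \<omega>) = (\<Pi>\<^sub>M i\<in>{..<m}. distr P borel (X i))"
    using X ne rvX by (subst (asm) P.indep_vars_iff_distr_eq_PiM') auto
  also have "\<dots> = (\<Pi>\<^sub>M i\<in>{..<m}. distr Q borel (Y i))"
    using law by (intro PiM_cong) auto
  also have "\<dots> = distr Q ?\<Pi> (\<lambda>\<omega>. \<lambda>i\<in>{..<m}. Y i \<omega>)"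
    using Y ne rvY by (subst (asm) Q.indep_vars_iff_distr_eq_PiM') auto
  finally have eq: "distr P ?\<Pi> (\<lambda>\<omega>. \<lambda>i\<in>{..<m}. X i \<omega>) = distr Q ?\<Pi> (\<lambda>\<omega>. \<lambda>i\<in>{..<m}. Y i \<omega>)" .
  let ?G = "{f \<in> space ?\<Pi>. (\<lambda>i. f i) \<in> G}"
  have G': "?G \<in> sets ?\<Pi>"
    by (rule coord_open_sets[OF G]) auto
  have cong: "restrict f {..<m} \<in> G \<longleftrightarrow> f \<in> G" for f
    by (rule coord_open_cong[OF G]) auto
  have "measure (distr P ?\<Pi> (\<lambda>\<omega>. \<lambda>i\<in>{..<m}. X i \<omega>)) ?G = measure P {\<omega> \<in> space P. (\<lambda>i. X i \<omega>) \<in> G}"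
    using G' by (subst measure_distr) (auto intro!: arg_cong[of _ _ "measure P"] simp: space_PiM cong)
  moreover have "measure (distr Q ?\<Pi> (\<lambda>\<omega>. \<lambda>i\<in>{..<m}. Y i \<omega>)) ?G = measure Q {\<omega> \<in> space Q. (\<lambda>i. Y i \<omega>) \<in> G}"
    using G' by (subst measure_distr) (auto intro!: arg_cong[of _ _ "measure Q"] simp: space_PiM cong)
  ultimately show ?thesis using eq by simp
qed

lemma indep_vars_PiM_coordinates:
  assumes I: "finite I" "I \<noteq> {}" and \<Omega>: "\<And>i. i \<in> I \<Longrightarrow> prob_space (\<Omega> i)"
    and f: "\<And>i. i \<in> I \<Longrightarrow> f i \<in> borel_measurable (\<Omega> i)"
  shows "prob_space.indep_vars (PiM I \<Omega>) (\<lambda>_. borel) (\<lambda>i \<omega>. f i (\<omega> i)) I"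
    and "i \<in> I \<Longrightarrow> distr (PiM I \<Omega>) borel (\<lambda>\<omega>. f i (\<omega> i)) = distr (\<Omega> i) borel (f i)"
proof -
  interpret prob_space "PiM I \<Omega>" by (rule prob_space_PiM) fact
  have "indep_vars \<Omega> (\<lambda>i \<omega>. \<omega> i) I"
  proof (subst indep_vars_iff_distr_eq_PiM')
    have "distr (PiM I \<Omega>) (PiM I \<Omega>) (\<lambda>\<omega>. \<lambda>i\<in>I. \<omega> i) = distr (PiM I \<Omega>) (PiM I \<Omega>) (\<lambda>\<omega>. \<omega>)"
      by (intro distr_cong) (auto simp: space_PiM)
    also have "\<dots> = (\<Pi>\<^sub>M i\<in>I. distr (PiM I \<Omega>) (\<Omega> i) (\<lambda>\<omega>. \<omega> i))"
      using distr_PiM_component[OF \<Omega>] by (subst distr_id) (auto intro!: PiM_cong sym[OF distr_PiM_component] \<Omega>)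
    finally show "distr (PiM I \<Omega>) (PiM I \<Omega>) (\<lambda>\<omega>. \<lambda>i\<in>I. \<omega> i) = (\<Pi>\<^sub>M i\<in>I. distr (PiM I \<Omega>) (\<Omega> i) (\<lambda>\<omega>. \<omega> i))" .
  qed (use I in auto)
  then show "indep_vars (\<lambda>_. borel) (\<lambda>i \<omega>. f i (\<omega> i)) I"
    by (rule indep_vars_compose2) (use f in auto)
  show "distr (PiM I \<Omega>) borel (\<lambda>\<omega>. f i (\<omega> i)) = distr (\<Omega> i) borel (f i)" if "i \<in> I"
  proof -
    have "distr (PiM I \<Omega>) borel (\<lambda>\<omega>. f i (\<omega> i)) = distr (distr (PiM I \<Omega>) (\<Omega> i) (\<lambda>\<omega>. \<omega> i)) borel (f i)"
      using that f by (subst distr_distr) (auto simp: comp_def)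
    also have "distr (PiM I \<Omega>) (\<Omega> i) (\<lambda>\<omega>. \<omega> i) = \<Omega> i"
      by (rule distr_PiM_component) (use \<Omega> that in auto)
    finally show ?thesis .
  qed
qed

text \<open>Skorohod's theorem in each coordinate reduces the joint convergence to almost sure
  convergence on a product space.\<close>

lemma coord_open_liminf:
  fixes P :: "nat \<Rightarrow> 'c measure" and X :: "nat \<Rightarrow> nat \<Rightarrow> 'c \<Rightarrow> real"
  assumes P: "\<And>j. prob_space (P j)" and Q: "prob_space Q"
    and G: "coord_open m G" and m: "m \<ge> 1"
    and X: "\<And>j. prob_space.indep_vars (P j) (\<lambda>_. borel) (X j) {..<m}"
    and Y: "prob_space.indep_vars Q (\<lambda>_. borel) Y {..<m}"
    and conv: "\<And>i. i < m \<Longrightarrow> weak_conv_m (\<lambda>j. distr (P j) borel (X j i)) (distr Q borel (Y i))"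
    and \<epsilon>: "\<epsilon> > 0"
  shows "eventually (\<lambda>j. measure (P j) {\<omega> \<in> space (P j). (\<lambda>i. X j i \<omega>) \<in> G}
    > measure Q {\<omega> \<in> space Q. (\<lambda>i. Y i \<omega>) \<in> G} - \<epsilon>) sequentially"
proof -
  interpret P: prob_space "P j" for j by (rule P)
  interpret Q: prob_space Q by fact
  have rvX: "X j i \<in> borel_measurable (P j)" if "i < m" for i j
    using X[of j] that by (auto simp: P.indep_vars_def)
  have rvY: "Y i \<in> borel_measurable Q" if "i < m" for i
    using Y that by (auto simp: Q.indep_vars_def)
  \<comment> \<open>The conclusion of \<open>Skorohod\<close> is packaged as one predicate so that a
    space and its variables can be chosen for all coordinates at once.\<close>
  define coupled where "coupled i \<Omega> U V \<longleftrightarrow> prob_space \<Omega> \<and> (\<forall>j. U j \<in> borel_measurable \<Omega>) \<and>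
      (\<forall>j. distr \<Omega> borel (U j) = distr (P j) borel (X j i)) \<and> V \<in> borel_measurable \<Omega> \<and>
      distr \<Omega> borel V = distr Q borel (Y i) \<and> (\<forall>x\<in>space \<Omega>. (\<lambda>j. U j x) \<longlonglongrightarrow> V x)"
    for i and \<Omega> :: "real measure" and U V
  have "\<exists>\<Omega> U V. coupled i \<Omega> U V" if i: "i < m" for i
  proof -
    have "real_distribution (distr (P j) borel (X j i))" for j
      using rvX[OF i] by (rule P.real_distribution_distr)
    moreover have "real_distribution (distr Q borel (Y i))"
      using rvY[OF i] by (rule Q.real_distribution_distr)
    ultimately show ?thesis
      using Skorohod[OF _ _ conv[OF i]] by (simp add: coupled_def)
  qed
  then obtain \<Omega> U V where "\<And>i. i < m \<Longrightarrow> coupled i (\<Omega> i) (U i) (V i)"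
    by metis
  then obtain \<Omega> :: "nat \<Rightarrow> real measure" and U V where
    \<Omega>: "\<And>i. i < m \<Longrightarrow> prob_space (\<Omega> i)" and
    U: "\<And>i j. i < m \<Longrightarrow> U i j \<in> borel_measurable (\<Omega> i)"
       "\<And>i j. i < m \<Longrightarrow> distr (\<Omega> i) borel (U i j) = distr (P j) borel (X j i)" and
    V: "\<And>i. i < m \<Longrightarrow> V i \<in> borel_measurable (\<Omega> i)"
       "\<And>i. i < m \<Longrightarrow> distr (\<Omega> i) borel (V i) = distr Q borel (Y i)" and
    lim: "\<And>i x. i < m \<Longrightarrow> x \<in> space (\<Omega> i) \<Longrightarrow> (\<lambda>j. U i j x) \<longlonglongrightarrow> V i x"
    unfolding coupled_def by blast
  define R where "R = PiM {..<m} \<Omega>"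
  interpret R: prob_space R unfolding R_def by (rule prob_space_PiM) (use \<Omega> in auto)
  have ne: "{..<m} \<noteq> {}" using m by (auto simp: lessThan_empty_iff)
  have comp: "(\<lambda>\<omega>. f (\<omega> i)) \<in> borel_measurable R" if "f \<in> borel_measurable (\<Omega> i)" "i < m" for f i
    unfolding R_def using that by (intro measurable_compose[OF measurable_component_singleton]) auto
  let ?A = "\<lambda>j. {\<omega> \<in> space R. (\<lambda>i. U i j (\<omega> i)) \<in> G}" and ?B = "{\<omega> \<in> space R. (\<lambda>i. V i (\<omega> i)) \<in> G}"
  have eqX: "measure (P j) {\<omega> \<in> space (P j). (\<lambda>i. X j i \<omega>) \<in> G} = measure R (?A j)" for j
  proof (rule coord_open_measure_eq[OF P R.prob_space_axioms G m X])
    show "R.indep_vars (\<lambda>_. borel) (\<lambda>i \<omega>. U i j (\<omega> i)) {..<m}"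
      unfolding R_def by (rule indep_vars_PiM_coordinates(1)) (simp_all add: ne \<Omega> U(1))
    show "distr (P j) borel (X j i) = distr R borel (\<lambda>\<omega>. U i j (\<omega> i))" if "i < m" for i
    proof -
      have "distr R borel (\<lambda>\<omega>. U i j (\<omega> i)) = distr (\<Omega> i) borel (U i j)"
        unfolding R_def
      proof (rule indep_vars_PiM_coordinates(2)[where i=i and f="\<lambda>i. U i j"])
        show "prob_space (\<Omega> k)" if "k \<in> {..<m}" for k using \<Omega> that by blast
        show "U k j \<in> borel_measurable (\<Omega> k)" if "k \<in> {..<m}" for k using U(1) that by blast
      qed (use ne \<open>i < m\<close> in blast)+
      also note U(2)[OF that]
      finally show ?thesis by (rule sym)
    qed
  qed
  have eqY: "measure Q {\<omega> \<in> space Q. (\<lambda>i. Y i \<omega>) \<in> G} = measure R ?B"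
  proof (rule coord_open_measure_eq[OF Q R.prob_space_axioms G m Y])
    show "R.indep_vars (\<lambda>_. borel) (\<lambda>i \<omega>. V i (\<omega> i)) {..<m}"
      unfolding R_def by (rule indep_vars_PiM_coordinates(1)) (simp_all add: ne \<Omega> V(1))
    show "distr Q borel (Y i) = distr R borel (\<lambda>\<omega>. V i (\<omega> i))" if "i < m" for i
    proof -
      have "distr R borel (\<lambda>\<omega>. V i (\<omega> i)) = distr (\<Omega> i) borel (V i)"
        unfolding R_def
      proof (rule indep_vars_PiM_coordinates(2)[where i=i and f="\<lambda>i. V i"])
        show "prob_space (\<Omega> k)" if "k \<in> {..<m}" for k using \<Omega> that by blast
        show "V k \<in> borel_measurable (\<Omega> k)" if "k \<in> {..<m}" for k using V(1) that by blast
      qed (use ne \<open>i < m\<close> in blast)+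
      also note V(2)[OF that]
      finally show ?thesis by (rule sym)
    qed
  qed
  have A [measurable]: "?A j \<in> sets R" for j
    by (rule coord_open_sets[OF G], rule comp[OF U(1)]) auto
  \<comment> \<open>\<open>?C k\<close> asks for membership from \<open>k\<close> on. Openness of
    \<open>G\<close> puts every point of \<open>?B\<close> into some \<open>?C k\<close>, and
    continuity from below does the rest.\<close>
  let ?C = "\<lambda>k. \<Inter>j\<in>{k..}. ?A j"
  have C: "?C k \<in> sets R" for k
    using A by (intro sets.countable_INT) auto
  have "(\<lambda>k. measure R (?C k)) \<longlonglongrightarrow> measure R (\<Union>k. ?C k)"
    using C by (intro R.finite_Lim_measure_incseq) (auto simp: incseq_def)
  moreover have "?B \<subseteq> (\<Union>k. ?C k)"
  proof
    fix \<omega> assume \<omega>: "\<omega> \<in> ?B"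
    then obtain e where e: "e > 0" "\<And>w. (\<And>i. i < m \<Longrightarrow> \<bar>w i - V i (\<omega> i)\<bar> < e) \<Longrightarrow> w \<in> G"
      using coord_openD[OF G, of "\<lambda>i. V i (\<omega> i)"] by (auto simp del: abs_less_iff)
    have "eventually (\<lambda>j. \<forall>i\<in>{..<m}. \<bar>U i j (\<omega> i) - V i (\<omega> i)\<bar> < e) sequentially"
    proof (intro eventually_ball_finite ballI)
      fix i assume i: "i \<in> {..<m}"
      then have "\<omega> i \<in> space (\<Omega> i)" using \<omega> by (auto simp: R_def space_PiM)
      then have "(\<lambda>j. U i j (\<omega> i)) \<longlonglongrightarrow> V i (\<omega> i)" using lim i by auto
      then show "eventually (\<lambda>j. \<bar>U i j (\<omega> i) - V i (\<omega> i)\<bar> < e) sequentially"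
        using e(1) by (auto simp: tendsto_iff dist_real_def)
    qed simp
    then obtain k where "\<And>j. j \<ge> k \<Longrightarrow> \<forall>i\<in>{..<m}. \<bar>U i j (\<omega> i) - V i (\<omega> i)\<bar> < e"
      by (auto simp: eventually_sequentially simp del: abs_less_iff)
    then have "\<omega> \<in> ?C k"
      using \<omega> e(2) by (auto simp del: abs_less_iff)
    then show "\<omega> \<in> (\<Union>k. ?C k)" by blast
  qed
  then have "measure R ?B \<le> measure R (\<Union>k. ?C k)"
    using C by (intro R.finite_measure_mono) auto
  ultimately have "eventually (\<lambda>k. measure R ?B - \<epsilon> < measure R (?C k)) sequentially"
    using \<epsilon> by (intro order_tendstoD(1)) auto
  then show ?thesis
  proof eventually_elim
    case (elim k)
    have "measure R (?C k) \<le> measure R (?A k)"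
      by (intro R.finite_measure_mono) auto
    then show ?case using elim eqX[of k] eqY by simp
  qed
qed

subsection \<open>Central limit theorem for weighted random signs\<close>

text \<open>Both functions agree with \<open>1 - x^2 / 2\<close> to third order: the error is at
  most \<open>x^4 / 24\<close> for the cosine, whose expansion has no cubic term, and
  \<open>y^2 = x^4 / 4\<close> for the exponential.\<close>

lemma abs_cos_minus_exp_le: "\<bar>cos x - exp (- x\<^sup>2 / 2)\<bar> \<le> x^4" for x :: real
proof -
  have "cmod (iexp x - (\<Sum>k\<le>3. (\<i> * x)^k / fact k)) \<le> \<bar>x\<bar>^(Suc 3) / fact (Suc 3)"
    by (rule iexp_approx1)
  moreover have "\<bar>Re (iexp x - (\<Sum>k\<le>3. (\<i> * x)^k / fact k))\<bar> \<le> cmod (iexp x - (\<Sum>k\<le>3. (\<i> * x)^k / fact k))"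
    by (rule abs_Re_le_cmod)
  moreover have "Re (iexp x - (\<Sum>k\<le>3. (\<i> * x)^k / fact k)) = cos x - (1 - x\<^sup>2 / 2)"
    by (simp add: numeral_eq_Suc Re_exp power2_eq_square)
  ultimately have c: "\<bar>cos x - (1 - x\<^sup>2 / 2)\<bar> \<le> x^4 / 24"
    by (simp add: fact_numeral power_even_abs)
  define y where "y = x\<^sup>2 / 2"
  have y: "0 \<le> y" by (simp add: y_def)
  have "1 - y \<le> exp (- y)" using exp_ge_add_one_self[of "- y"] by simp
  moreover have "exp (- y) \<le> 1 - y + y\<^sup>2"
  proof -
    have "exp (- y) = inverse (exp y)" by (rule exp_minus)
    also have "\<dots> \<le> inverse (1 + y)" using y exp_ge_add_one_self[of y] by (intro le_imp_inverse_le) auto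
    also have "\<dots> \<le> 1 - y + y\<^sup>2"
    proof -
      \<comment> \<open>The right-hand side equals \<open>1 + y^3\<close>.\<close>
      have "1 \<le> (1 - y + y\<^sup>2) * (1 + y)" using y by (simp add: algebra_simps power2_eq_square)
      then show ?thesis using y by (simp add: inverse_eq_divide divide_le_eq)
    qed
    finally show ?thesis .
  qed
  moreover have "y\<^sup>2 = x^4 / 4" by (simp add: y_def power_divide flip: power_mult)
  moreover have "0 \<le> x^4" by simp
  moreover have "exp (- x\<^sup>2 / 2) = exp (- y)" by (simp add: y_def)
  ultimately show ?thesis
    using c unfolding y_def[symmetric] abs_le_iff by linarith
qed

lemma indep_vars_signs:
  assumes "finite A"
  shows "prob_space.indep_vars (measure_pmf (signs A)) (\<lambda>_. borel) (\<lambda>i e. e i * c i) A"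
proof -
  have "prob_space.indep_vars (measure_pmf (signs A)) (\<lambda>_. count_space UNIV) (\<lambda>i e. e i) A"
    unfolding signs_def by (rule indep_vars_Pi_pmf) fact
  then show ?thesis
    by (rule prob_space.indep_vars_compose2[OF measure_pmf.prob_space_axioms]) auto
qed

lemma char_sign:
  assumes "finite A" "i \<in> A"
  shows "char (distr (measure_pmf (signs A)) borel (\<lambda>e. e i * c)) t = complex_of_real (cos (t * c))"
proof -
  have "char (distr (measure_pmf (signs A)) borel (\<lambda>e. e i * c)) t = measure_pmf.expectation (signs A) (\<lambda>e. iexp (t * (e i * c)))"
    by (simp add: char_def integral_distr)
  also have "\<dots> = measure_pmf.expectation (map_pmf (\<lambda>e. e i) (signs A)) (\<lambda>s. iexp (t * (s * c)))"
    by simp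
  also have "map_pmf (\<lambda>e. e i) (signs A) = pmf_of_set {-1, 1}"
    using assms by (simp add: signs_def Pi_pmf_component)
  also have "measure_pmf.expectation (pmf_of_set {-1, 1}) (\<lambda>s. iexp (t * (s * c))) = complex_of_real (cos (t * c))"
    by (subst integral_measure_pmf[where A="{-1, 1}"]) (auto simp: complex_eq_iff Re_exp Im_exp)
  finally show ?thesis .
qed

text \<open>The characteristic function is a product of cosines, compared factor by factor with
  Gaussian ones. The errors are fourth powers and add up to at most \<open>t^4 * \<delta> j\<close>
  times the variance, which vanishes with the largest weight.\<close>

lemma signs_clt:
  assumes A: "\<And>j. finite (A j)" "\<And>j. B j \<subseteq> A j"
    and var: "(\<lambda>j. \<Sum>i\<in>B j. (a j i)\<^sup>2) \<longlonglongrightarrow> 1"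
    and small: "\<And>j i. i \<in> B j \<Longrightarrow> (a j i)\<^sup>2 \<le> \<delta> j" "\<delta> \<longlonglongrightarrow> 0"
  shows "weak_conv_m (\<lambda>j. distr (measure_pmf (signs (A j))) borel (\<lambda>e. \<Sum>i\<in>B j. e i * a j i)) std_normal_distribution"
proof (rule levy_continuity)
  fix t :: real
  let ?\<phi> = "\<lambda>j. char (distr (measure_pmf (signs (A j))) borel (\<lambda>e. \<Sum>i\<in>B j. e i * a j i)) t"
  let ?v = "\<lambda>j. \<Sum>i\<in>B j. (a j i)\<^sup>2"
  have \<phi>: "?\<phi> j = of_real (\<Prod>i\<in>B j. cos (t * a j i))" for j
  proof -
    have "?\<phi> j = (\<Prod>i\<in>B j. char (distr (measure_pmf (signs (A j))) borel (\<lambda>e. e i * a j i)) t)"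
      by (intro prob_space.char_distr_sum[OF measure_pmf.prob_space_axioms]
          prob_space.indep_vars_subset[OF measure_pmf.prob_space_axioms indep_vars_signs]) (use A in auto)
    also have "\<dots> = (\<Prod>i\<in>B j. of_real (cos (t * a j i)))"
      using A by (intro prod.cong refl char_sign) auto
    finally show ?thesis by simp
  qed
  have bound: "norm (?\<phi> j - of_real (exp (- (t\<^sup>2 * ?v j) / 2))) \<le> t^4 * (\<delta> j * ?v j)" for j
  proof -
    have fin: "finite (B j)" using A finite_subset by blast
    have exp_eq: "exp (- (t\<^sup>2 * ?v j) / 2) = (\<Prod>i\<in>B j. exp (- (t * a j i)\<^sup>2 / 2))"
      using fin by (simp add: exp_sum[symmetric] sum_distrib_left power_mult_distrib sum_negf sum_divide_distrib)
    have "norm (?\<phi> j - of_real (exp (- (t\<^sup>2 * ?v j) / 2))) =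
        \<bar>(\<Prod>i\<in>B j. cos (t * a j i)) - (\<Prod>i\<in>B j. exp (- (t * a j i)\<^sup>2 / 2))\<bar>"
      unfolding \<phi> exp_eq of_real_diff[symmetric] norm_of_real ..
    \<comment> \<open>All factors have modulus at most 1, so the products differ by at most the sum
      of the differences.\<close>
    also have "\<dots> \<le> (\<Sum>i\<in>B j. \<bar>cos (t * a j i) - exp (- (t * a j i)\<^sup>2 / 2)\<bar>)"
      unfolding real_norm_def[symmetric] by (intro norm_prod_diff) auto
    also have "\<dots> \<le> (\<Sum>i\<in>B j. t^4 * (\<delta> j * (a j i)\<^sup>2))"
    proof (rule sum_mono)
      fix i assume i: "i \<in> B j"
      have "\<bar>cos (t * a j i) - exp (- (t * a j i)\<^sup>2 / 2)\<bar> \<le> (t * a j i)^4"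
        by (rule abs_cos_minus_exp_le)
      also have "\<dots> = t^4 * ((a j i)\<^sup>2 * (a j i)\<^sup>2)"
        by (simp add: power_mult_distrib flip: power_add)
      also have "\<dots> \<le> t^4 * (\<delta> j * (a j i)\<^sup>2)"
        using small(1)[OF i] by (intro mult_left_mono mult_right_mono) auto
      finally show "\<bar>cos (t * a j i) - exp (- (t * a j i)\<^sup>2 / 2)\<bar> \<le> t^4 * (\<delta> j * (a j i)\<^sup>2)" .
    qed
    also have "\<dots> = t^4 * (\<delta> j * ?v j)" by (simp add: sum_distrib_left)
    finally show ?thesis .
  qed
  have "(\<lambda>j. t^4 * (\<delta> j * ?v j)) \<longlonglongrightarrow> t^4 * (0 * 1)"
    by (intro tendsto_intros var small(2))
  then have "(\<lambda>j. ?\<phi> j - of_real (exp (- (t\<^sup>2 * ?v j) / 2))) \<longlonglongrightarrow> 0"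
    by (intro Lim_null_comparison[OF always_eventually[OF allI[OF bound]]]) (simp only: mult_zero_left mult_zero_right)
  moreover have "(\<lambda>j. complex_of_real (exp (- (t\<^sup>2 * ?v j) / 2))) \<longlonglongrightarrow> of_real (exp (- (t\<^sup>2 * 1) / 2))"
    by (intro tendsto_intros var) auto
  ultimately have "?\<phi> \<longlonglongrightarrow> of_real (exp (- (t\<^sup>2 * 1) / 2))"
    using tendsto_add by fastforce
  then show "?\<phi> \<longlonglongrightarrow> char std_normal_distribution t"
    by (simp add: char_std_normal_distribution)
qed (auto intro!: real_dist_normal_dist prob_space.real_distribution_distr[OF measure_pmf.prob_space_axioms])

subsection \<open>Finite-dimensional approximation of sublevel sets\<close>

text \<open>Grid values \<open>v\<close> for which a whole uniform neighbourhood, of radius exceeding \<open>\<eta>\<close>, of the step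
  function with these values lies in the sublevel set \<open>{h < x}\<close>.\<close>

definition step_nbhd :: "((real \<Rightarrow> real) \<Rightarrow> real) \<Rightarrow> real \<Rightarrow> nat \<Rightarrow> real \<Rightarrow> (nat \<Rightarrow> real) set" where
  "step_nbhd h x m \<eta> =
     {v. \<exists>\<eta>'>\<eta>. \<forall>y\<in>D01. (\<forall>t\<in>{0..1}. \<bar>v (nat \<lfloor>t * real m\<rfloor>) - y t\<bar> \<le> \<eta>') \<longrightarrow> h y < x}"

text \<open>The index \<open>m\<close> does occur, at \<open>t = 1\<close>, so the step function has
  \<open>Suc m\<close> values.\<close>

lemma grid_index_le: "t \<in> {0..1} \<Longrightarrow> nat \<lfloor>t * real m\<rfloor> < Suc m"
proof -
  assume "t \<in> {0..1}"
  then have "t * real m \<le> real m" using mult_right_mono[of t 1 "real m"] by simp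
  then have "\<lfloor>t * real m\<rfloor> \<le> int m" by linarith
  then show ?thesis by linarith
qed

lemma abs_diff_le_add:
  fixes a b c p q :: real
  assumes "\<bar>a - b\<bar> < p" "\<bar>a - c\<bar> \<le> q"
  shows "\<bar>b - c\<bar> \<le> p + q"
  using assms by linarith

lemma step_nbhd_antimono: "\<eta>1 \<le> \<eta>2 \<Longrightarrow> step_nbhd h x m \<eta>2 \<subseteq> step_nbhd h x m \<eta>1"
  unfolding step_nbhd_def by (auto intro: order.strict_trans1)

text \<open>This is the purpose of the strict excess \<open>\<eta>' > \<eta>\<close> in
  \<open>step_nbhd\<close>: moving the grid values by less than half of it still leaves the radius
  \<open>(\<eta>' + \<eta>) / 2 > \<eta>\<close>.\<close>

lemma coord_open_step_nbhd: "coord_open (Suc m) (step_nbhd h x m \<eta>)"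
  unfolding coord_open_def
proof
  fix v assume "v \<in> step_nbhd h x m \<eta>"
  then obtain \<eta>' where \<eta>': "\<eta>' > \<eta>"
    "\<And>y. y \<in> D01 \<Longrightarrow> (\<And>t. t \<in> {0..1} \<Longrightarrow> \<bar>v (nat \<lfloor>t * real m\<rfloor>) - y t\<bar> \<le> \<eta>') \<Longrightarrow> h y < x"
    unfolding step_nbhd_def by blast
  show "\<exists>\<epsilon>>0. \<forall>w. (\<forall>i<Suc m. \<bar>w i - v i\<bar> < \<epsilon>) \<longrightarrow> w \<in> step_nbhd h x m \<eta>"
  proof (intro exI[of _ "(\<eta>' - \<eta>) / 2"] conjI allI impI)
    fix w assume w: "\<forall>i<Suc m. \<bar>w i - v i\<bar> < (\<eta>' - \<eta>) / 2"
    have "h y < x" if y: "y \<in> D01" "\<forall>t\<in>{0..1}. \<bar>w (nat \<lfloor>t * real m\<rfloor>) - y t\<bar> \<le> (\<eta>' + \<eta>) / 2" for y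
    proof (rule \<eta>'(2)[OF y(1)])
      fix t :: real assume t: "t \<in> {0..1}"
      have "\<bar>w (nat \<lfloor>t * real m\<rfloor>) - v (nat \<lfloor>t * real m\<rfloor>)\<bar> < (\<eta>' - \<eta>) / 2"
        using w grid_index_le[OF t] by blast
      moreover have "\<bar>w (nat \<lfloor>t * real m\<rfloor>) - y t\<bar> \<le> (\<eta>' + \<eta>) / 2"
        using y(2) t by blast
      ultimately have "\<bar>v (nat \<lfloor>t * real m\<rfloor>) - y t\<bar> \<le> (\<eta>' - \<eta>) / 2 + (\<eta>' + \<eta>) / 2"
        by (rule abs_diff_le_add)
      then show "\<bar>v (nat \<lfloor>t * real m\<rfloor>) - y t\<bar> \<le> \<eta>'"
        by (simp add: field_simps)
    qed
    then show "w \<in> step_nbhd h x m \<eta>"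
      unfolding step_nbhd_def using \<eta>'(1) by (intro CollectI exI[of _ "(\<eta>' + \<eta>) / 2"]) auto
  qed (use \<eta>'(1) in simp)
qed

lemma wiener_measurable: "wiener_process N W \<Longrightarrow> t \<in> {0..1} \<Longrightarrow> W t \<in> borel_measurable N"
  by (auto simp: wiener_process_def)

text \<open>Of the continuity radius \<delta>, one quarter covers the oscillation of the path over a
  grid step and one quarter is the neighbourhood of the step function. The remaining half keeps
  \<open>sup_dist\<close> strictly below \<delta>, since a supremum preserves only weak
  inequalities.\<close>

lemma wiener_grid_in_step_nbhd:
  assumes W: "wiener_process N W" and \<omega>: "\<omega> \<in> space N"
    and cont: "sup_continuous_at h (path W \<omega>)" and less: "h (path W \<omega>) < x"
  shows "\<exists>\<eta>0>0. \<exists>m0. \<forall>m\<ge>m0. \<forall>\<eta><\<eta>0. (\<lambda>i. W (real i / real m) \<omega>) \<in> step_nbhd h x m \<eta>"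
proof -
  obtain \<delta> where \<delta>: "\<delta> > 0"
    "\<And>y. y \<in> D01 \<Longrightarrow> sup_dist (path W \<omega>) y < \<delta> \<Longrightarrow> \<bar>h (path W \<omega>) - h y\<bar> < x - h (path W \<omega>)"
    using cont less unfolding sup_continuous_at_def by (metis diff_gt_0_iff_gt)
  have near: "h y < x" if y: "y \<in> D01" "\<And>t. t \<in> {0..1} \<Longrightarrow> \<bar>W t \<omega> - y t\<bar> \<le> \<delta> / 2" for y
  proof -
    have "sup_dist (path W \<omega>) y \<le> \<delta> / 2"
      using y(2) by (intro sup_dist_le) (simp add: path_def)
    then show ?thesis using \<delta>(1) \<delta>(2)[OF y(1)] by (simp add: abs_less_iff)
  qed
  have "continuous_on {0..1} (\<lambda>t. W t \<omega>)"
    using W \<omega> by (simp add: wiener_process_def)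
  then have "uniformly_continuous_on {0..1} (\<lambda>t. W t \<omega>)"
    by (intro compact_uniformly_continuous) auto
  then obtain d where d: "d > 0"
    "\<And>s t. s \<in> {0..1} \<Longrightarrow> t \<in> {0..1} \<Longrightarrow> dist s t < d \<Longrightarrow> dist (W s \<omega>) (W t \<omega>) < \<delta> / 4"
    using \<delta>(1) unfolding uniformly_continuous_on_def by (metis zero_less_divide_iff zero_less_numeral)
  have "(\<lambda>i. W (real i / real m) \<omega>) \<in> step_nbhd h x m \<eta>"
    if m: "m \<ge> nat \<lceil>1 / d\<rceil> + 1" and \<eta>: "\<eta> < \<delta> / 4" for m \<eta>
    unfolding step_nbhd_def
  proof (intro CollectI exI[of _ "\<delta> / 4"] conjI ballI impI)
    fix y assume y: "y \<in> D01" "\<forall>t\<in>{0..1}. \<bar>W (real (nat \<lfloor>t * real m\<rfloor>) / real m) \<omega> - y t\<bar> \<le> \<delta> / 4"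
    have "real m > 1 / d" using m by linarith
    then have md: "1 / real m < d" and m0: "m > 0"
      using d(1) m by (auto simp: field_simps)
    show "h y < x"
    proof (rule near[OF y(1)])
      fix t :: real assume t: "t \<in> {0..1}"
      let ?s = "real (nat \<lfloor>t * real m\<rfloor>) / real m"
      have "0 \<le> t * real m" using t by simp
      then have "real (nat \<lfloor>t * real m\<rfloor>) \<le> t * real m" "t * real m < real (nat \<lfloor>t * real m\<rfloor>) + 1"
        by linarith+
      then have "?s \<le> t" "t < ?s + 1 / real m"
        using m0 by (auto simp: field_simps)
      then have "dist ?s t < d" "?s \<in> {0..1}"
        using md t by (auto simp: dist_real_def)
      then have "\<bar>W ?s \<omega> - W t \<omega>\<bar> < \<delta> / 4" using d(2) t by (metis dist_real_def)
      moreover have "\<bar>W ?s \<omega> - y t\<bar> \<le> \<delta> / 4" using y(2) t by blast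
      ultimately have "\<bar>W t \<omega> - y t\<bar> \<le> \<delta> / 4 + \<delta> / 4" by (rule abs_diff_le_add)
      then show "\<bar>W t \<omega> - y t\<bar> \<le> \<delta> / 2" by simp
    qed
  qed (use \<eta> in simp)
  then show ?thesis
    using \<delta>(1) by (intro exI[of _ "\<delta> / 4"] conjI exI[of _ "nat \<lceil>1 / d\<rceil> + 1"]) auto
qed

text \<open>The sets \<open>F k\<close> increase and exhaust the event up to a null set. Tying the
  radius \<open>1 / (k + 1)\<close> and the grid bound to the single parameter \<open>k\<close> lets
  continuity from below choose both together; intersecting over \<open>m \<ge> k\<close> makes the
  bound uniform in \<open>m\<close>.\<close>

lemma wiener_step_nbhd_prob:
  assumes W: "wiener_process N W" and h: "h \<in> borel_measurable D01_algebra"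
    and cont: "AE w in distr N D01_algebra (path W). sup_continuous_at h w" and \<epsilon>: "\<epsilon> > 0"
  shows "\<exists>\<eta>>0. \<exists>m0. \<forall>m\<ge>m0. measure N {\<omega> \<in> space N. (\<lambda>i. W (real i / real m) \<omega>) \<in> step_nbhd h x m \<eta>}
    > measure N {\<omega> \<in> space N. h (path W \<omega>) < x} - \<epsilon>"
proof -
  interpret prob_space N using W by (simp add: wiener_process_def)
  let ?A = "{\<omega> \<in> space N. h (path W \<omega>) < x}"
  have [measurable]: "(\<lambda>\<omega>. h (path W \<omega>)) \<in> borel_measurable N"
    using path_wiener_measurable[OF W] h by (rule measurable_compose)
  let ?S = "\<lambda>m \<eta>. {\<omega> \<in> space N. (\<lambda>i. W (real i / real m) \<omega>) \<in> step_nbhd h x m \<eta>}"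
  have S [measurable]: "?S m \<eta> \<in> sets N" for m \<eta>
    by (rule coord_open_sets[OF coord_open_step_nbhd wiener_measurable[OF W grid_in_unit]]) auto
  define F where "F k = (\<Inter>m\<in>{k..}. ?S m (1 / real (Suc k)))" for k
  have F [measurable]: "F k \<in> sets N" for k
    unfolding F_def using S by (intro sets.countable_INT) auto
  have "incseq F"
    unfolding incseq_Suc_iff
  proof
    fix k
    have "step_nbhd h x m (1 / real (Suc k)) \<subseteq> step_nbhd h x m (1 / real (Suc (Suc k)))" for m
      by (intro step_nbhd_antimono) (simp add: field_simps)
    then show "F k \<subseteq> F (Suc k)"
      unfolding F_def by fastforce
  qed
  then have lim: "(\<lambda>k. measure N (F k)) \<longlonglongrightarrow> measure N (\<Union>k. F k)"
    by (intro finite_Lim_measure_incseq) auto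
  have "AE \<omega> in N. sup_continuous_at h (path W \<omega>)"
    using AE_distrD[OF path_wiener_measurable[OF W] cont] .
  then have "AE \<omega> in N. \<omega> \<in> ?A \<longrightarrow> \<omega> \<in> (\<Union>k. F k)"
  proof (rule AE_mp, intro AE_I2 impI)
    fix \<omega> assume \<omega>: "\<omega> \<in> space N" "sup_continuous_at h (path W \<omega>)" "\<omega> \<in> ?A"
    then obtain \<eta>0 m0 where \<eta>0: "\<eta>0 > 0"
      "\<And>m \<eta>. m \<ge> m0 \<Longrightarrow> \<eta> < \<eta>0 \<Longrightarrow> (\<lambda>i. W (real i / real m) \<omega>) \<in> step_nbhd h x m \<eta>"
      using wiener_grid_in_step_nbhd[OF W \<omega>(1,2), of x] by blast
    obtain k1 where k1: "1 / real (Suc k1) < \<eta>0"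
      using \<eta>0(1) reals_Archimedean by (metis inverse_eq_divide)
    have "1 / real (Suc (max k1 m0)) \<le> 1 / real (Suc k1)" by (simp add: frac_le)
    then have "\<omega> \<in> F (max k1 m0)"
      unfolding F_def using \<omega>(1) \<eta>0(2) k1 by auto
    then show "\<omega> \<in> (\<Union>k. F k)" by blast
  qed
  then have "measure N ?A \<le> measure N (\<Union>k. F k)"
    by (intro finite_measure_mono_AE) auto
  then have "eventually (\<lambda>k. measure N ?A - \<epsilon> < measure N (F k)) sequentially"
    using \<epsilon> by (intro order_tendstoD(1)[OF lim]) auto
  then obtain k where k: "measure N ?A - \<epsilon> < measure N (F k)"
    by (auto simp: eventually_sequentially)
  have "measure N (F k) \<le> measure N (?S m (1 / real (Suc k)))" if "m \<ge> k" for m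
    using that by (intro finite_measure_mono) (auto simp: F_def)
  then show ?thesis
    using k by (intro exI[of _ "1 / real (Suc k)"] conjI exI[of _ k] allI impI) (auto intro: less_le_trans)
qed

text \<open>The factor \<open>sqrt m\<close> makes increments over a step \<open>1/m\<close> standard normal in the limit.\<close>

definition step_nbhd_incr :: "((real \<Rightarrow> real) \<Rightarrow> real) \<Rightarrow> real \<Rightarrow> nat \<Rightarrow> real \<Rightarrow> (nat \<Rightarrow> real) set" where
  "step_nbhd_incr h x m \<eta> = {d. (\<lambda>k. (\<Sum>i<k. d i) / sqrt (real m)) \<in> step_nbhd h x m \<eta>}"

lemma coord_open_step_nbhd_incr:
  assumes m: "m \<ge> 1"
  shows "coord_open m (step_nbhd_incr h x m \<eta>)"
  unfolding coord_open_def
proof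
  fix v assume "v \<in> step_nbhd_incr h x m \<eta>"
  then have "(\<lambda>k. (\<Sum>i<k. v i) / sqrt (real m)) \<in> step_nbhd h x m \<eta>"
    by (simp add: step_nbhd_incr_def)
  then obtain \<epsilon> where \<epsilon>: "\<epsilon> > 0"
    "\<And>w. (\<And>i. i < Suc m \<Longrightarrow> \<bar>w i - (\<Sum>l<i. v l) / sqrt (real m)\<bar> < \<epsilon>) \<Longrightarrow> w \<in> step_nbhd h x m \<eta>"
    by (rule coord_openD[OF coord_open_step_nbhd]) blast
  show "\<exists>\<epsilon>>0. \<forall>w. (\<forall>i<m. \<bar>w i - v i\<bar> < \<epsilon>) \<longrightarrow> w \<in> step_nbhd_incr h x m \<eta>"
  proof (intro exI[of _ "\<epsilon> / real m"] conjI allI impI)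
    fix w assume w: "\<forall>i<m. \<bar>w i - v i\<bar> < \<epsilon> / real m"
    have "\<bar>(\<Sum>l<i. w l) / sqrt (real m) - (\<Sum>l<i. v l) / sqrt (real m)\<bar> < \<epsilon>" if "i < Suc m" for i
    proof -
      have "\<bar>(\<Sum>l<i. w l) / sqrt (real m) - (\<Sum>l<i. v l) / sqrt (real m)\<bar> = \<bar>\<Sum>l<i. w l - v l\<bar> / sqrt (real m)"
        using m by (simp add: sum_subtractf diff_divide_distrib[symmetric])
      also have "\<dots> \<le> \<bar>\<Sum>l<i. w l - v l\<bar>"
        using m by (simp add: divide_le_eq mult_le_cancel_left1)
      also have "\<dots> \<le> (\<Sum>l<i. \<bar>w l - v l\<bar>)" by (rule sum_abs)
      also have "\<dots> \<le> (\<Sum>l<m. \<bar>w l - v l\<bar>)"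
        using that by (intro sum_mono2) auto
      also have "\<dots> < (\<Sum>l<m. \<epsilon> / real m)"
        using w m by (intro sum_strict_mono) (auto simp: lessThan_empty_iff)
      also have "\<dots> = \<epsilon>" using m by simp
      finally show ?thesis .
    qed
    then show "w \<in> step_nbhd_incr h x m \<eta>"
      unfolding step_nbhd_incr_def by (intro CollectI \<epsilon>(2))
  qed (use \<epsilon>(1) m in simp)
qed

lemma wiener_grid_increments:
  assumes W: "wiener_process N W" and m: "m \<ge> 1"
  defines "Y \<equiv> \<lambda>i \<omega>. (W (real (Suc i) / real m) \<omega> - W (real i / real m) \<omega>) * sqrt (real m)"
  shows "prob_space.indep_vars N (\<lambda>_. borel) Y {..<m}"
    and "i < m \<Longrightarrow> distr N borel (Y i) = std_normal_distribution"
    and "measure N {\<omega> \<in> space N. (\<lambda>i. Y i \<omega>) \<in> step_nbhd_incr h x m \<eta>} =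
      measure N {\<omega> \<in> space N. (\<lambda>i. W (real i / real m) \<omega>) \<in> step_nbhd h x m \<eta>}"
proof -
  interpret prob_space N using W by (simp add: wiener_process_def)
  have step: "real i / real m < real (Suc i) / real m" for i
    using m by (intro divide_strict_right_mono) auto
  have "\<forall>(k::nat) \<tau>. (\<forall>i\<le>k. \<tau> i \<in> {0..1}) \<and> (\<forall>i<k. \<tau> i < \<tau> (Suc i)) \<longrightarrow>
        indep_vars (\<lambda>_. borel) (\<lambda>i \<omega>. W (\<tau> (Suc i)) \<omega> - W (\<tau> i) \<omega>) {..<k}"
    using W unfolding wiener_process_def by (elim conjE)
  note ind = this[THEN spec, THEN spec, THEN mp, of m "\<lambda>i. real i / real m"]
  have "(\<forall>i\<le>m. real i / real m \<in> {0..1}) \<and> (\<forall>i<m. real i / real m < real (Suc i) / real m)"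
    using grid_in_unit step by blast
  then have "indep_vars (\<lambda>_. borel) (\<lambda>i \<omega>. W (real (Suc i) / real m) \<omega> - W (real i / real m) \<omega>) {..<m}"
    by (rule ind)
  then show indep: "indep_vars (\<lambda>_. borel) Y {..<m}"
    unfolding Y_def by (rule indep_vars_compose2) simp
  show "distr N borel (Y i) = std_normal_distribution" if i: "i < m"
  proof -
    have diff: "real (Suc i) / real m - real i / real m = 1 / real m"
      by (simp add: diff_divide_distrib[symmetric])
    have "0 \<le> real i / real m \<and> real i / real m < real (Suc i) / real m \<and> real (Suc i) / real m \<le> 1"
      using step grid_in_unit[of "Suc i" m] i by auto
    then have "distributed N lborel (\<lambda>\<omega>. W (real (Suc i) / real m) \<omega> - W (real i / real m) \<omega>)
        (normal_density 0 (sqrt (1 / real m)))"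
      using W unfolding wiener_process_def diff[symmetric] by blast
    then have "distributed N lborel (\<lambda>\<omega>. (W (real (Suc i) / real m) \<omega> - W (real i / real m) \<omega> - 0) / sqrt (1 / real m))
        std_normal_density"
      using m by (subst (asm) normal_standard_normal_convert) auto
    then have "distributed N lborel (Y i) std_normal_density"
      by (simp add: Y_def real_sqrt_divide)
    then have "distr N lborel (Y i) = density lborel std_normal_density"
      by (rule distributed_distr_eq_density)
    then show ?thesis by (simp add: distr_cong[of N N borel lborel "Y i" "Y i"])
  qed
  have rv: "Y i \<in> borel_measurable N" if "i < m" for i
    using indep that by (auto simp: indep_vars_def)
  \<comment> \<open>Telescoping recovers the grid values minus \<open>W 0\<close>, which is 0 only
    almost surely; hence the two events agree up to a null set.\<close>
  have "AE \<omega> in N. W 0 \<omega> = 0"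
    using W by (simp add: wiener_process_def)
  then show "measure N {\<omega> \<in> space N. (\<lambda>i. Y i \<omega>) \<in> step_nbhd_incr h x m \<eta>} =
      measure N {\<omega> \<in> space N. (\<lambda>i. W (real i / real m) \<omega>) \<in> step_nbhd h x m \<eta>}"
  proof (intro measure_eq_AE)
    assume "AE \<omega> in N. W 0 \<omega> = 0"
    then show "AE \<omega> in N. \<omega> \<in> {\<omega> \<in> space N. (\<lambda>i. Y i \<omega>) \<in> step_nbhd_incr h x m \<eta>} \<longleftrightarrow>
        \<omega> \<in> {\<omega> \<in> space N. (\<lambda>i. W (real i / real m) \<omega>) \<in> step_nbhd h x m \<eta>}"
    proof eventually_elim
      case (elim \<omega>)
      have "(\<Sum>i<k. Y i \<omega>) / sqrt (real m) = W (real k / real m) \<omega>" for k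
      proof -
        have "(\<Sum>i<k. Y i \<omega>) = (W (real k / real m) \<omega> - W (real 0 / real m) \<omega>) * sqrt (real m)"
          unfolding Y_def sum_distrib_right[symmetric] by (subst sum_lessThan_telescope) simp
        then show ?thesis using m elim by simp
      qed
      then show ?case by (simp add: step_nbhd_incr_def)
    qed
  next
    show "{\<omega> \<in> space N. (\<lambda>i. Y i \<omega>) \<in> step_nbhd_incr h x m \<eta>} \<in> events"
      by (rule coord_open_sets[OF coord_open_step_nbhd_incr[OF m]]) (rule rv)
    show "{\<omega> \<in> space N. (\<lambda>i. W (real i / real m) \<omega>) \<in> step_nbhd h x m \<eta>} \<in> events"
      by (rule coord_open_sets[OF coord_open_step_nbhd wiener_measurable[OF W grid_in_unit]]) auto
  qed
qed

subsection \<open>The Student process of a weighted sequence of random signs\<close>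

lemma sum_block:
  fixes f :: "nat \<Rightarrow> real"
  assumes "p \<le> q"
  shows "(\<Sum>l\<in>{p<..q}. f l) = (\<Sum>l=1..q. f l) - (\<Sum>l=1..p. f l)"
proof -
  have "{1..q} = {1..p} \<union> {p<..q}" using assms by auto
  then have "(\<Sum>l=1..q. f l) = (\<Sum>l=1..p. f l) + (\<Sum>l\<in>{p<..q}. f l)"
    by (simp only:) (rule sum.union_disjoint, auto)
  then show ?thesis by simp
qed

text \<open>The first index left out would push the sum of squares over the level, so less than one
  square is missing. If no index is left out, the sum is 1, which is at least any level.\<close>

lemma block_end_variance:
  assumes V: "(\<Sum>l=1..n. (a l)\<^sup>2) = 1" and \<delta>: "\<And>l. 1 \<le> l \<Longrightarrow> l \<le> n \<Longrightarrow> (a l)\<^sup>2 \<le> \<delta>"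
    and im: "i \<le> m" "m \<ge> 1"
  shows "\<bar>(\<Sum>l=1..block_end n a m i. (a l)\<^sup>2) - real i / real m\<bar> \<le> \<delta>"
proof -
  let ?b = "block_end n a m i"
  have n: "n \<ge> 1" using V by (cases n) auto
  have \<delta>0: "\<delta> \<ge> 0" using \<delta>[of 1] n zero_le_power2[of "a 1"] by linarith
  have up: "(\<Sum>l=1..?b. (a l)\<^sup>2) \<le> real i / real m" by (rule block_end_props)
  have lo: "real i / real m - \<delta> \<le> (\<Sum>l=1..?b. (a l)\<^sup>2)"
  proof (cases "?b = n")
    case True
    then show ?thesis using grid_in_unit[OF im(1)] \<delta>0 V by simp
  next
    case False
    then have b: "Suc ?b \<le> n" using block_end_props(1)[of n a m i] by simp
    then have "(\<Sum>l=1..Suc ?b. (a l)\<^sup>2) > real i / real m"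
      using block_end_props(3)[of "Suc ?b" n a i m] by force
    then show ?thesis using \<delta>[of "Suc ?b"] b by simp
  qed
  show ?thesis using up lo by simp
qed

lemma block_variance:
  assumes V: "(\<Sum>l=1..n. (a l)\<^sup>2) = 1" and \<delta>: "\<And>l. 1 \<le> l \<Longrightarrow> l \<le> n \<Longrightarrow> (a l)\<^sup>2 \<le> \<delta>"
    and im: "i < m"
  shows "\<bar>(\<Sum>l\<in>{block_end n a m i<..block_end n a m (Suc i)}. (a l)\<^sup>2) - 1 / real m\<bar> \<le> 2 * \<delta>"
proof -
  have "real (Suc i) / real m - real i / real m = 1 / real m"
    by (simp add: diff_divide_distrib[symmetric])
  then show ?thesis
    using block_end_variance[OF V \<delta>, of i m] block_end_variance[OF V \<delta>, of "Suc i" m] im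
    by (simp add: sum_block[OF block_end_mono] abs_le_iff)
qed

section \<open>Oscillation, independence and limit law of the block sums\<close>

lemma AE_signs: "finite A \<Longrightarrow> AE e in measure_pmf (signs A). \<forall>i\<in>A. e i \<in> {-1, 1}"
  by (auto simp: AE_measure_pmf_iff signs_def set_Pi_pmf PiE_dflt_def)

text \<open>The maximal inequality, started at 0 in every block, followed by a union bound over the
  blocks.\<close>

lemma prob_signs_oscillation:
  assumes \<eta>: "\<eta> > 0" and v: "\<And>i. i < m \<Longrightarrow> (\<Sum>l\<in>{b i<..b (Suc i)}. (a l)\<^sup>2) \<le> v"
    and b: "\<And>i. i < m \<Longrightarrow> b i \<le> b (Suc i)" "\<And>i. i < m \<Longrightarrow> b (Suc i) \<le> n"
  shows "measure_pmf.prob (signs {1..n})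
      {e. \<exists>i<m. \<exists>k\<in>{b i..b (Suc i)}. \<eta> \<le> \<bar>\<Sum>l\<in>{b i<..k}. e l * a l\<bar>} \<le> real m * (3 * v\<^sup>2 / \<eta>^4)"
proof -
  let ?E = "\<lambda>i. {e :: nat \<Rightarrow> real. \<exists>k\<in>{b i..b (Suc i)}. \<eta> \<le> \<bar>0 + (\<Sum>l\<in>{b i<..k}. e l * a l)\<bar>}"
  have "{e. \<exists>i<m. \<exists>k\<in>{b i..b (Suc i)}. \<eta> \<le> \<bar>\<Sum>l\<in>{b i<..k}. e l * a l\<bar>} = (\<Union>i\<in>{..<m}. ?E i)"
    by auto
  also have "measure_pmf.prob (signs {1..n}) \<dots> \<le> (\<Sum>i\<in>{..<m}. measure_pmf.prob (signs {1..n}) (?E i))"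
    by (intro measure_pmf.finite_measure_subadditive_finite) auto
  also have "\<dots> \<le> (\<Sum>i\<in>{..<m}. 3 * v\<^sup>2 / \<eta>^4)"
  proof (rule sum_mono)
    fix i assume "i \<in> {..<m}"
    then have i: "i < m" by simp
    let ?v = "\<Sum>l\<in>{b i<..b (Suc i)}. (a l)\<^sup>2"
    have sub: "{b i<..b (Suc i)} \<subseteq> {1..n}" using b(2)[OF i] by auto
    have "measure_pmf.prob (signs {1..n}) (?E i) \<le> (0^4 + 6 * 0\<^sup>2 * ?v + 3 * ?v\<^sup>2) / \<eta>^4"
      by (rule prob_signs_maximal[OF _ sub b(1)[OF i] \<eta>]) simp
    also have "\<dots> = 3 * ?v\<^sup>2 / \<eta>^4" by simp
    also have "\<dots> \<le> 3 * v\<^sup>2 / \<eta>^4"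
      using v[OF i] by (intro divide_right_mono mult_left_mono power_mono sum_nonneg) auto
    finally show "measure_pmf.prob (signs {1..n}) (?E i) \<le> 3 * v\<^sup>2 / \<eta>^4" .
  qed
  finally show ?thesis by simp
qed

lemma indep_vars_sign_blocks:
  assumes mono: "\<And>i j. i \<le> j \<Longrightarrow> b i \<le> b j" and n: "\<And>i. i < m \<Longrightarrow> b (Suc i) \<le> n"
  shows "prob_space.indep_vars (measure_pmf (signs {1..n})) (\<lambda>_. borel)
    (\<lambda>i e. \<Sum>l\<in>{b i<..b (Suc i)}. e l * c l) {..<m}"
proof -
  let ?K = "\<lambda>i. {b i<..b (Suc i)}"
  have "disjoint_family_on ?K {..<m}"
    unfolding disjoint_family_on_def
  proof (intro ballI impI)
    fix i j :: nat assume "i \<noteq> j"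
    then show "?K i \<inter> ?K j = {}"
      using mono[of "Suc i" j] mono[of "Suc j" i] by (cases i j rule: linorder_cases) auto
  qed
  then have "prob_space.indep_vars (measure_pmf (signs {1..n})) (\<lambda>i. PiM (?K i) (\<lambda>_. borel))
      (\<lambda>i e. restrict (\<lambda>l. e l * c l) (?K i)) {..<m}"
    by (intro prob_space.indep_vars_restrict[OF measure_pmf.prob_space_axioms indep_vars_signs])
       (use n in force)+
  then have "prob_space.indep_vars (measure_pmf (signs {1..n})) (\<lambda>_. borel)
      (\<lambda>i e. \<Sum>l\<in>?K i. restrict (\<lambda>l. e l * c l) (?K i) l) {..<m}"
    by (rule prob_space.indep_vars_compose2[OF measure_pmf.prob_space_axioms])
       (intro borel_measurable_sum measurable_component_singleton)
  moreover have "(\<Sum>l\<in>?K i. restrict (\<lambda>l. e l * c l) (?K i) l) = (\<Sum>l\<in>?K i. e l * c l)" for i and e :: "nat \<Rightarrow> real"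
    by (intro sum.cong) auto
  ultimately show ?thesis by (simp only:)
qed

text \<open>For fixed \<open>m\<close> the block variance tends to \<open>1 / m\<close>, and after
  scaling by \<open>sqrt m\<close> the largest square is at most \<open>\<delta> j * m\<close>,
  which tends to 0; these are the two limits asked for by \<open>signs_clt\<close>.\<close>

lemma sign_blocks_weak_conv:
  assumes V: "\<And>j. (\<Sum>l=1..n j. (a j l)\<^sup>2) = 1"
    and \<delta>: "\<And>j l. 1 \<le> l \<Longrightarrow> l \<le> n j \<Longrightarrow> (a j l)\<^sup>2 \<le> \<delta> j" "\<delta> \<longlonglongrightarrow> 0" and im: "i < m"
  shows "weak_conv_m (\<lambda>j. distr (measure_pmf (signs {1..n j})) borel
      (\<lambda>e. \<Sum>l\<in>{block_end (n j) (a j) m i<..block_end (n j) (a j) m (Suc i)}. e l * (a j l * sqrt (real m))))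
      std_normal_distribution"
proof (rule signs_clt[where \<delta>="\<lambda>j. \<delta> j * real m"])
  let ?B = "\<lambda>j. {block_end (n j) (a j) m i<..block_end (n j) (a j) m (Suc i)}"
  let ?v = "\<lambda>j. \<Sum>l\<in>?B j. (a j l)\<^sup>2"
  show sub: "?B j \<subseteq> {1..n j}" for j
    using block_end_props(1)[of "n j" "a j" m "Suc i"] by auto
  have "(\<lambda>j. ?v j - 1 / real m) \<longlonglongrightarrow> 0"
  proof (rule Lim_null_comparison)
    show "eventually (\<lambda>j. norm (?v j - 1 / real m) \<le> 2 * \<delta> j) sequentially"
      using block_variance[OF V \<delta>(1) im] by simp
    show "(\<lambda>j. 2 * \<delta> j) \<longlonglongrightarrow> 0"
      using tendsto_mult_right_zero[OF \<delta>(2)] .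
  qed
  then have "?v \<longlonglongrightarrow> 1 / real m"
    by (simp add: LIM_zero_iff)
  then have "(\<lambda>j. ?v j * real m) \<longlonglongrightarrow> 1 / real m * real m"
    by (intro tendsto_intros)
  then show "(\<lambda>j. \<Sum>l\<in>?B j. (a j l * sqrt (real m))\<^sup>2) \<longlonglongrightarrow> 1"
    using im by (simp add: power_mult_distrib sum_distrib_right[symmetric])
  show "(a j l * sqrt (real m))\<^sup>2 \<le> \<delta> j * real m" if "l \<in> ?B j" for j l
    using \<delta>(1)[of l j] that sub[of j] by (auto simp: power_mult_distrib intro!: mult_right_mono)
  show "(\<lambda>j. \<delta> j * real m) \<longlonglongrightarrow> 0"
    using tendsto_mult_left_zero[OF \<delta>(2)] .
qed simp

text \<open>The deterministic core, for one sign vector. Signs do not alter squares, so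
  \<open>e l * a l\<close> has the blocks of \<open>a\<close>. The increments in
  \<open>step_nbhd_incr\<close> telescope to partial sums at block ends, and the approximation error
  \<open>3 * \<eta>\<close> is below the radius that \<open>step_nbhd\<close> supplies.\<close>

lemma student_below_if_blocks:
  assumes n: "n \<ge> 2" and m: "m \<ge> 1" and V: "(\<Sum>l=1..n. (a l)\<^sup>2) = 1"
    and e: "\<And>l. l \<in> {1..n} \<Longrightarrow> e l \<in> {-1, 1::real}"
    and osc: "\<And>i k. i < m \<Longrightarrow> block_end n a m i \<le> k \<Longrightarrow> k \<le> block_end n a m (Suc i) \<Longrightarrow>
        \<bar>\<Sum>l\<in>{block_end n a m i<..k}. e l * a l\<bar> < \<eta>"
    and large: "4 * (real m * \<eta>)\<^sup>2 * real m \<le> real n" "(real m * \<eta>)\<^sup>2 < real n"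
       "real m * \<eta> * ((real m * \<eta>)\<^sup>2 + 1) \<le> \<eta> * (real n - (real m * \<eta>)\<^sup>2)"
    and G: "(\<lambda>i. \<Sum>l\<in>{block_end n a m i<..block_end n a m (Suc i)}. e l * (a l * sqrt (real m)))
        \<in> step_nbhd_incr h x m (3 * \<eta>)"
  shows "h (path (\<lambda>t e. student_process n 0 (\<lambda>l. e l * a l) t) e) < x"
proof -
  let ?z = "\<lambda>l. e l * a l" and ?b = "block_end n a m"
  have z2: "(?z l)\<^sup>2 = (a l)\<^sup>2" if "l \<in> {1..n}" for l
    using e[OF that] by (auto simp: power_mult_distrib)
  have V': "(\<Sum>l=1..n. (?z l)\<^sup>2) = 1"
    using V by (subst sum.cong[OF refl z2])
  have b: "block_end n ?z m = ?b"
  proof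
    fix j
    have "(\<Sum>l=1..k. (?z l)\<^sup>2) = (\<Sum>l=1..k. (a l)\<^sup>2)" if "k \<le> n" for k
      using that by (intro sum.cong refl z2) auto
    then show "block_end n ?z m j = ?b j"
      unfolding block_end_def by (intro arg_cong[of _ _ Max]) auto
  qed
  have grid: "(\<Sum>i<k. \<Sum>l\<in>{?b i<..?b (Suc i)}. e l * (a l * sqrt (real m))) / sqrt (real m) = (\<Sum>l=1..?b k. ?z l)" for k
  proof -
    have "(\<Sum>i<k. \<Sum>l\<in>{?b i<..?b (Suc i)}. e l * (a l * sqrt (real m))) =
        (\<Sum>i<k. (\<Sum>l=1..?b (Suc i). ?z l) - (\<Sum>l=1..?b i. ?z l)) * sqrt (real m)"
      unfolding sum_distrib_right by (intro sum.cong refl)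
        (simp add: sum_block[OF block_end_mono] sum_distrib_right left_diff_distrib mult.assoc)
    also have "\<dots> = (\<Sum>l=1..?b k. ?z l) * sqrt (real m)"
      using sum_before_first_block[of "?b 0" n ?z m] by (subst sum_lessThan_telescope) (simp add: b)
    finally show ?thesis using m by simp
  qed
  have "(\<lambda>k. \<Sum>l=1..?b k. ?z l) \<in> step_nbhd h x m (3 * \<eta>)"
    using G unfolding step_nbhd_incr_def mem_Collect_eq grid .
  then obtain \<eta>' where \<eta>': "\<eta>' > 3 * \<eta>"
    "\<And>y. y \<in> D01 \<Longrightarrow> (\<And>t. t \<in> {0..1} \<Longrightarrow> \<bar>(\<Sum>l=1..?b (nat \<lfloor>t * real m\<rfloor>). ?z l) - y t\<bar> \<le> \<eta>') \<Longrightarrow> h y < x"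
    unfolding step_nbhd_def by blast
  show ?thesis
  proof (rule \<eta>'(2)[OF student_path_in_D01])
    fix t :: real assume t: "t \<in> {0..1}"
    have osc': "\<bar>(\<Sum>l=1..k. ?z l) - (\<Sum>l=1..block_end n ?z m j. ?z l)\<bar> \<le> \<eta>"
      if "j < m" "block_end n ?z m j \<le> k" "k \<le> block_end n ?z m (Suc j)" for j k
      using osc[of j k] that by (simp add: b sum_block)
    have "\<bar>student_process n 0 ?z t - (\<Sum>l=1..block_end n ?z m (nat \<lfloor>t * real m\<rfloor>). ?z l)\<bar> \<le> 3 * \<eta>"
      by (rule student_process_near_block_sums[OF n m V' osc' refl large]) (use t in auto)
    then show "\<bar>(\<Sum>l=1..?b (nat \<lfloor>t * real m\<rfloor>). ?z l) - path (\<lambda>t e. student_process n 0 (\<lambda>l. e l * a l) t) e t\<bar> \<le> \<eta>'"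
      using \<eta>'(1) t by (simp add: b path_def abs_minus_commute)
  qed
qed

text \<open>The loss \<epsilon> is shared equally by three steps: replacing the Wiener path by its
  grid values, the joint limit theorem for the block sums, and the oscillation inside the
  blocks.\<close>

lemma sign_student_liminf:
  assumes W: "wiener_process N W" and h: "h \<in> borel_measurable D01_algebra"
    and cont: "AE w in distr N D01_algebra (path W). sup_continuous_at h w"
    and n: "filterlim n at_top sequentially"
    and V: "\<And>j. (\<Sum>l=1..n j. (a j l)\<^sup>2) = 1"
    and \<delta>: "\<And>j l. 1 \<le> l \<Longrightarrow> l \<le> n j \<Longrightarrow> (a j l)\<^sup>2 \<le> \<delta> j" "\<delta> \<longlonglongrightarrow> 0"
    and \<epsilon>: "\<epsilon> > 0"
  shows "eventually (\<lambda>j. measure_pmf.prob (signs {1..n j})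
      {e. h (path (\<lambda>t e. student_process (n j) 0 (\<lambda>l. e l * a j l) t) e) < x}
    > measure N {\<omega> \<in> space N. h (path W \<omega>) < x} - \<epsilon>) sequentially"
proof -
  let ?p = "measure N {\<omega> \<in> space N. h (path W \<omega>) < x}"
  have "\<epsilon> / 3 > 0" using \<epsilon> by simp
  from wiener_step_nbhd_prob[OF W h cont this, of x] obtain \<eta>0 m0 where \<eta>0: "\<eta>0 > 0" and
    m0: "\<And>m. m \<ge> m0 \<Longrightarrow> ?p - \<epsilon> / 3 < measure N {\<omega> \<in> space N. (\<lambda>i. W (real i / real m) \<omega>) \<in> step_nbhd h x m \<eta>0}"
    by blast
  define \<eta> where "\<eta> = \<eta>0 / 3"
  have \<eta>: "\<eta> > 0" "\<eta>0 = 3 * \<eta>" using \<eta>0 by (auto simp: \<eta>_def)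
  \<comment> \<open>Blocks of variance at most \<open>2 / m\<close> give the oscillation bound
    \<open>12 / (m * \<eta>^4)\<close>, which is at most \<open>\<epsilon> / 3\<close> for
    \<open>m \<ge> 36 / (\<eta>^4 * \<epsilon>)\<close>.\<close>
  define m where "m = max (m0 + 1) (nat \<lceil>36 / (\<eta>^4 * \<epsilon>)\<rceil> + 1)"
  have m: "m \<ge> m0" "m \<ge> 1" by (auto simp: m_def)
  have "36 / (\<eta>^4 * \<epsilon>) \<le> real m" unfolding m_def by linarith
  then have m_large: "real m * (3 * (2 / real m)\<^sup>2 / \<eta>^4) \<le> \<epsilon> / 3"
    using \<eta> \<epsilon> m by (simp add: field_simps power2_eq_square)
  let ?b = "\<lambda>j. block_end (n j) (a j) m"
  let ?Y = "\<lambda>i \<omega>. (W (real (Suc i) / real m) \<omega> - W (real i / real m) \<omega>) * sqrt (real m)"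
  let ?X = "\<lambda>j i e. \<Sum>l\<in>{?b j i<..?b j (Suc i)}. e l * (a j l * sqrt (real m))"
  let ?G = "step_nbhd_incr h x m (3 * \<eta>)"
  let ?P = "\<lambda>j. measure_pmf.prob (signs {1..n j})"
  have "eventually (\<lambda>j. measure (measure_pmf (signs {1..n j})) {e \<in> space (measure_pmf (signs {1..n j})). (\<lambda>i. ?X j i e) \<in> ?G}
      > measure N {\<omega> \<in> space N. (\<lambda>i. ?Y i \<omega>) \<in> ?G} - \<epsilon> / 3) sequentially"
  proof (rule coord_open_liminf)
    show "prob_space N" using W by (simp add: wiener_process_def)
    show "coord_open m ?G" by (rule coord_open_step_nbhd_incr[OF m(2)])
    show "prob_space.indep_vars N (\<lambda>_. borel) ?Y {..<m}"
      by (rule wiener_grid_increments(1)[OF W m(2)])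
    show "prob_space.indep_vars (measure_pmf (signs {1..n j})) (\<lambda>_. borel) (?X j) {..<m}" for j
      by (rule indep_vars_sign_blocks) (auto intro: block_end_mono block_end_props(1))
    show "weak_conv_m (\<lambda>j. distr (measure_pmf (signs {1..n j})) borel (?X j i)) (distr N borel (?Y i))"
      if "i < m" for i
      unfolding wiener_grid_increments(2)[OF W m(2) that]
      by (rule sign_blocks_weak_conv[OF V \<delta> that])
  qed (use m \<epsilon> in \<open>auto intro: measure_pmf.prob_space_axioms\<close>)
  then have ev1: "eventually (\<lambda>j. ?P j {e. (\<lambda>i. ?X j i e) \<in> ?G} > ?p - \<epsilon> / 3 - \<epsilon> / 3) sequentially"
    unfolding wiener_grid_increments(3)[OF W m(2)]
    by (rule eventually_mono) (use m0[OF m(1)] in \<open>simp add: \<eta>(2)\<close>)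
  \<comment> \<open>Block variances are within \<open>2 * \<delta> j\<close> of
    \<open>1 / m\<close>, hence below \<open>2 / m\<close> from here on.\<close>
  have ev2: "eventually (\<lambda>j. \<delta> j < 1 / (2 * real m)) sequentially"
    by (rule order_tendstoD(2)[OF \<delta>(2)]) (use m in simp)
  have large: "eventually (\<lambda>j. c \<le> real (n j)) sequentially" for c
    using filterlim_compose[OF filterlim_real_sequentially n] unfolding filterlim_at_top by blast
  define C where "C = real m * \<eta>"
  have "eventually (\<lambda>j. ?P j {e. h (path (\<lambda>t e. student_process (n j) 0 (\<lambda>l. e l * a j l) t) e) < x}
      > ?p - \<epsilon> / 3 - \<epsilon> / 3 - \<epsilon> / 3) sequentially"
    using ev1 ev2 large[of 2] large[of "4 * C\<^sup>2 * real m"] large[of "C\<^sup>2 + 1"]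
      large[of "C * (C\<^sup>2 + 1) / \<eta> + C\<^sup>2"]
  proof eventually_elim
    case (elim j)
    let ?bad = "{e. \<exists>i<m. \<exists>k\<in>{?b j i..?b j (Suc i)}. \<eta> \<le> \<bar>\<Sum>l\<in>{?b j i<..k}. e l * a j l\<bar>}"
    let ?good = "{e. h (path (\<lambda>t e. student_process (n j) 0 (\<lambda>l. e l * a j l) t) e) < x}"
    have "?P j ?bad \<le> real m * (3 * (2 / real m)\<^sup>2 / \<eta>^4)"
    proof (rule prob_signs_oscillation[OF \<eta>(1)])
      fix i assume i: "i < m"
      have "2 * \<delta> j < 1 / real m" using elim(2) m by (simp add: field_simps)
      then show "(\<Sum>l\<in>{?b j i<..?b j (Suc i)}. (a j l)\<^sup>2) \<le> 2 / real m"
        using block_variance[OF V \<delta>(1) i, of j] by (simp add: abs_le_iff)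
    qed (auto intro: block_end_mono block_end_props(1))
    then have bad: "?P j ?bad \<le> \<epsilon> / 3" using m_large by linarith
    \<comment> \<open>Vectors with entries other than 1 and -1 on \<open>{1..n j}\<close> have
      probability 0, so the inclusion of events is stated almost surely.\<close>
    have "AE e in measure_pmf (signs {1..n j}). e \<in> {e. (\<lambda>i. ?X j i e) \<in> ?G} \<longrightarrow> e \<in> ?bad \<union> ?good"
      using AE_signs[OF finite_atLeastAtMost, of 1 "n j"]
    proof (rule eventually_mono, intro impI)
      fix e assume e: "\<forall>i\<in>{1..n j}. e i \<in> {-1, 1}" and G: "e \<in> {e. (\<lambda>i. ?X j i e) \<in> ?G}"
      show "e \<in> ?bad \<union> ?good"
      proof (cases "e \<in> ?bad")
        case False
        have "h (path (\<lambda>t e. student_process (n j) 0 (\<lambda>l. e l * a j l) t) e) < x"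
        proof (rule student_below_if_blocks[where m=m and \<eta>=\<eta>])
          show "n j \<ge> 2" using elim(3) by simp
          show "m \<ge> 1" by (rule m(2))
          show "(\<Sum>l=1..n j. (a j l)\<^sup>2) = 1" by (rule V)
          show "e l \<in> {-1, 1}" if "l \<in> {1..n j}" for l using e that by blast
          show "\<bar>\<Sum>l\<in>{?b j i<..k}. e l * a j l\<bar> < \<eta>"
            if "i < m" "?b j i \<le> k" "k \<le> ?b j (Suc i)" for i k
            using False that unfolding mem_Collect_eq by (meson atLeastAtMost_iff not_le)
          show "4 * (real m * \<eta>)\<^sup>2 * real m \<le> real (n j)"
            using elim(4) unfolding C_def .
          show "(real m * \<eta>)\<^sup>2 < real (n j)"
            using elim(5) unfolding C_def by linarith
          have "C * (C\<^sup>2 + 1) / \<eta> \<le> real (n j) - C\<^sup>2" using elim(6) by linarith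
          then have "C * (C\<^sup>2 + 1) \<le> \<eta> * (real (n j) - C\<^sup>2)"
            using \<eta>(1) by (simp add: divide_le_eq mult.commute)
          then show "real m * \<eta> * ((real m * \<eta>)\<^sup>2 + 1) \<le> \<eta> * (real (n j) - (real m * \<eta>)\<^sup>2)"
            unfolding C_def .
          show "(\<lambda>i. ?X j i e) \<in> ?G" using G by simp
        qed
        then show ?thesis by simp
      qed simp
    qed
    then have "?P j {e. (\<lambda>i. ?X j i e) \<in> ?G} \<le> ?P j (?bad \<union> ?good)"
      by (intro measure_pmf.finite_measure_mono_AE) auto
    also have "\<dots> \<le> ?P j ?bad + ?P j ?good"
      by (rule measure_Un_le) auto
    finally show ?case using elim(1) bad by linarith
  qed
  then show ?thesis by (rule eventually_mono) simp
qed

subsection \<open>Symmetrisation\<close>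

text \<open>Conditioning on the observations requires one pair of bounds on ratio and sample size
  for all weights. If no pair worked, counterexamples with shrinking ratios would form a triangular
  array that contradicts \<open>sign_student_liminf\<close>.\<close>

lemma sign_student_uniform:
  assumes W: "wiener_process N W" and h: "h \<in> borel_measurable D01_algebra"
    and cont: "AE w in distr N D01_algebra (path W). sup_continuous_at h w" and \<epsilon>: "\<epsilon> > 0"
  shows "\<exists>\<delta>>0. \<exists>n0. \<forall>n\<ge>n0. \<forall>y. max_ratio n 0 y \<le> \<delta> \<longrightarrow>
    measure_pmf.prob (signs {1..n}) {e. h (path (\<lambda>t e. student_process n 0 (\<lambda>l. e l * y l) t) e) < x}
      > measure N {\<omega> \<in> space N. h (path W \<omega>) < x} - \<epsilon>"
proof (rule ccontr)
  define large where "large n y \<longleftrightarrow>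
    measure_pmf.prob (signs {1..n}) {e. h (path (\<lambda>t e. student_process n 0 (\<lambda>l. e l * y l) t) e) < x}
      > measure N {\<omega> \<in> space N. h (path W \<omega>) < x} - \<epsilon>" for n y
  assume "\<not> ?thesis"
  then have neg: "\<not> (\<exists>\<delta>>0. \<exists>n0. \<forall>n\<ge>n0. \<forall>y. max_ratio n 0 y \<le> \<delta> \<longrightarrow> large n y)"
    unfolding large_def .
  \<comment> \<open>The \<open>+ 2\<close> keeps the bound below 1, the value that
    \<open>max_ratio\<close> takes by convention on vanishing weights; so every \<open>V k\<close>
    is positive and can be divided out.\<close>
  have "\<exists>n y. n \<ge> k \<and> max_ratio n 0 y \<le> 1 / (real k + 2) \<and> \<not> large n y" for k
  proof (rule ccontr)
    assume "\<not> (\<exists>n y. n \<ge> k \<and> max_ratio n 0 y \<le> 1 / (real k + 2) \<and> \<not> large n y)"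
    then have "\<forall>n\<ge>k. \<forall>y. max_ratio n 0 y \<le> 1 / (real k + 2) \<longrightarrow> large n y" by blast
    moreover have "1 / (real k + 2) > 0" by simp
    ultimately show False using neg by blast
  qed
  then obtain n y where ny: "\<And>k. n k \<ge> k" "\<And>k. max_ratio (n k) 0 (y k) \<le> 1 / (real k + 2)"
      "\<And>k. \<not> large (n k) (y k)"
    by metis
  define V where "V k = (\<Sum>l=1..n k. (y k l)\<^sup>2)" for k
  have V: "V k > 0" for k
  proof -
    have "1 / (real k + 2) < 1" by simp
    then have "max_ratio (n k) 0 (y k) \<noteq> 1" using ny(2)[of k] by linarith
    then have "V k \<noteq> 0" by (auto simp: max_ratio_def V_def)
    moreover have "V k \<ge> 0" by (simp add: V_def sum_nonneg)
    ultimately show ?thesis by linarith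
  qed
  define a where "a k l = y k l / sqrt (V k)" for k l
  have "eventually (\<lambda>k. measure_pmf.prob (signs {1..n k})
      {e. h (path (\<lambda>t e. student_process (n k) 0 (\<lambda>l. e l * a k l) t) e) < x}
    > measure N {\<omega> \<in> space N. h (path W \<omega>) < x} - \<epsilon>) sequentially"
  proof (rule sign_student_liminf[OF W h cont _ _ _ _ \<epsilon>, where \<delta>="\<lambda>k. 1 / (real k + 2)"])
    show "filterlim n at_top sequentially"
      using ny(1) by (intro filterlim_at_top_mono[OF filterlim_ident]) auto
    show "(\<Sum>l=1..n k. (a k l)\<^sup>2) = 1" for k
    proof -
      have "(\<Sum>l=1..n k. (a k l)\<^sup>2) = (\<Sum>l=1..n k. (y k l)\<^sup>2) / V k"
        using V[of k] by (simp add: a_def power_divide sum_divide_distrib)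
      then show ?thesis using V[of k] unfolding V_def[symmetric] by simp
    qed
    show "(a k l)\<^sup>2 \<le> 1 / (real k + 2)" if "1 \<le> l" "l \<le> n k" for k l
    proof -
      have "(a k l)\<^sup>2 = (y k l)\<^sup>2 / V k"
        using V[of k] by (simp add: a_def power_divide)
      also have "\<dots> \<le> (MAX i\<in>{1..n k}. (y k i)\<^sup>2) / V k"
        using that V[of k] by (intro divide_right_mono Max_ge) auto
      also have "\<dots> = max_ratio (n k) 0 (y k)"
        using V[of k] by (simp add: max_ratio_def V_def)
      finally show ?thesis using ny(2)[of k] by linarith
    qed
    show "(\<lambda>k. 1 / (real k + 2)) \<longlonglongrightarrow> 0"
      by (intro real_tendsto_divide_at_top[OF tendsto_const] filterlim_at_top_add_at_top
          filterlim_tendsto_add_at_top[OF tendsto_const, where c=2, unfolded add.commute[of 2]] filterlim_real_sequentially)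
  qed
  moreover have "student_process (n k) 0 (\<lambda>l. e l * a k l) t = student_process (n k) 0 (\<lambda>l. e l * y k l) t" for k e t
  proof -
    have "(\<lambda>l. e l * y k l) = (\<lambda>l. sqrt (V k) * (e l * a k l))"
      using V[of k] by (auto simp: a_def)
    then show ?thesis using student_process_scale[of "sqrt (V k)"] V[of k] by simp
  qed
  ultimately have "eventually (\<lambda>k. large (n k) (y k)) sequentially"
    unfolding large_def by simp
  then show False using ny(3) by (simp add: eventually_sequentially)
qed

lemma student_functional_measurable:
  fixes h :: "(real \<Rightarrow> real) \<Rightarrow> real"
  assumes h: "h \<in> borel_measurable D01_algebra"
    and Y: "\<And>i. i \<in> {1..n} \<Longrightarrow> Y i \<in> borel_measurable M"
  shows "(\<lambda>\<omega>. h (path (\<lambda>t \<omega>. student_process n 0 (\<lambda>i. Y i \<omega>) t) \<omega>)) \<in> borel_measurable M"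
proof -
  have "path (\<lambda>t \<omega>. student_process n 0 (\<lambda>i. Y i \<omega>) t) \<in> measurable M D01_algebra"
    using Y by (intro path_measurable student_process_measurable student_path_in_D01) auto
  then show ?thesis using h by (rule measurable_compose)
qed

text \<open>Each \<open>e i * Y i\<close> has the law of \<open>Y i\<close> and independence is
  kept, so the joint laws agree. The functional is then read as a measurable function on the finite
  product.\<close>

lemma student_functional_sign_invariant:
  fixes h :: "(real \<Rightarrow> real) \<Rightarrow> real"
  assumes M: "prob_space M" and Y: "prob_space.indep_vars M (\<lambda>_. borel) Y {1..}"
    and sym: "\<And>i. i \<ge> 1 \<Longrightarrow> distr M borel (Y i) = distr M borel (\<lambda>\<omega>. - Y i \<omega>)"
    and h: "h \<in> borel_measurable D01_algebra" and n: "n \<ge> 1"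
    and e: "\<And>i. i \<in> {1..n} \<Longrightarrow> e i \<in> {-1, 1::real}"
  shows "measure M {\<omega> \<in> space M. h (path (\<lambda>t \<omega>. student_process n 0 (\<lambda>i. e i * Y i \<omega>) t) \<omega>) < x} =
    measure M {\<omega> \<in> space M. h (path (\<lambda>t \<omega>. student_process n 0 (\<lambda>i. Y i \<omega>) t) \<omega>) < x}"
proof -
  interpret prob_space M by fact
  let ?\<Pi> = "\<Pi>\<^sub>M i\<in>{1..n}. (borel :: real measure)"
  have Yn: "indep_vars (\<lambda>_. borel) Y {1..n}"
    using Y by (rule indep_vars_subset) auto
  have eYn: "indep_vars (\<lambda>_. borel) (\<lambda>i \<omega>. e i * Y i \<omega>) {1..n}"
    using Yn by (rule indep_vars_compose2) simp
  have rv: "Y i \<in> borel_measurable M" if "i \<in> {1..n}" for i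
    using Yn that by (auto simp: indep_vars_def)
  have rve: "(\<lambda>\<omega>. e i * Y i \<omega>) \<in> borel_measurable M" if "i \<in> {1..n}" for i
    using rv[OF that] by simp
  have ne: "{1..n} \<noteq> {}" using n by simp
  have "distr M borel (\<lambda>\<omega>. e i * Y i \<omega>) = distr M borel (Y i)" if "i \<in> {1..n}" for i
    using e[OF that] sym[of i] that by auto
  then have "distr M ?\<Pi> (\<lambda>\<omega>. \<lambda>i\<in>{1..n}. e i * Y i \<omega>) = (\<Pi>\<^sub>M i\<in>{1..n}. distr M borel (Y i))"
    using indep_vars_iff_distr_eq_PiM'[OF ne rve] eYn by (auto intro!: PiM_cong)
  also have "\<dots> = distr M ?\<Pi> (\<lambda>\<omega>. \<lambda>i\<in>{1..n}. Y i \<omega>)"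
    using indep_vars_iff_distr_eq_PiM'[OF ne rv] Yn by simp
  finally have law: "distr M ?\<Pi> (\<lambda>\<omega>. \<lambda>i\<in>{1..n}. e i * Y i \<omega>) = distr M ?\<Pi> (\<lambda>\<omega>. \<lambda>i\<in>{1..n}. Y i \<omega>)" .
  let ?F = "\<lambda>f. h (path (\<lambda>t f. student_process n 0 (\<lambda>i. f i) t) f)"
  have F: "?F \<in> borel_measurable ?\<Pi>"
    by (rule student_functional_measurable[OF h]) auto
  have S: "{f \<in> space ?\<Pi>. ?F f < x} \<in> sets ?\<Pi>"
    using F by measurable
  \<comment> \<open>Restriction makes the coordinates outside \<open>{1..n}\<close> undefined, but
    the process does not look at them.\<close>
  have restr: "path (\<lambda>t f. student_process n 0 (\<lambda>i. f i) t) (\<lambda>i\<in>{1..n}. X i \<omega>) =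
      path (\<lambda>t \<omega>. student_process n 0 (\<lambda>i. X i \<omega>) t) \<omega>" for X :: "nat \<Rightarrow> 'a \<Rightarrow> real" and \<omega>
    unfolding path_def by (intro restrict_ext student_process_cong) auto
  have pull: "measure (distr M ?\<Pi> (\<lambda>\<omega>. \<lambda>i\<in>{1..n}. X i \<omega>)) {f \<in> space ?\<Pi>. ?F f < x} =
      measure M {\<omega> \<in> space M. h (path (\<lambda>t \<omega>. student_process n 0 (\<lambda>i. X i \<omega>) t) \<omega>) < x}"
    if "\<And>i. i \<in> {1..n} \<Longrightarrow> X i \<in> borel_measurable M" for X
  proof -
    have "(\<lambda>\<omega>. \<lambda>i\<in>{1..n}. X i \<omega>) \<in> measurable M ?\<Pi>"
      using that by (rule measurable_restrict)
    then show ?thesis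
      using S by (subst measure_distr) (auto intro!: arg_cong[of _ _ "measure M"] simp: space_PiM restr[simplified])
  qed
  show ?thesis
    using pull[of "\<lambda>i \<omega>. e i * Y i \<omega>", OF rve] pull[of Y, OF rv] law by simp
qed

lemma max_ratio_measurable:
  assumes "\<And>i. i \<in> {1..n} \<Longrightarrow> Y i \<in> borel_measurable M"
  shows "(\<lambda>\<omega>. max_ratio n 0 (\<lambda>i. Y i \<omega>)) \<in> borel_measurable M"
proof -
  have [measurable]: "(\<lambda>\<omega>. \<Sum>i=1..n. (Y i \<omega> - 0)\<^sup>2) \<in> borel_measurable M"
    using assms by (intro borel_measurable_sum borel_measurable_power borel_measurable_diff) auto
  have [measurable]: "(\<lambda>\<omega>. MAX i\<in>{1..n}. (Y i \<omega> - 0)\<^sup>2) \<in> borel_measurable M"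
    using assms by (intro borel_measurable_Max borel_measurable_power borel_measurable_diff) auto
  show ?thesis unfolding max_ratio_def by measurable
qed

text \<open>The law of the observations is invariant under sign changes, so the probability is the
  expectation, over the observations, of the probability with respect to independent random signs.\<close>

lemma student_symmetrised_lower_bound:
  fixes h :: "(real \<Rightarrow> real) \<Rightarrow> real"
  assumes M: "prob_space M" and Y: "prob_space.indep_vars M (\<lambda>_. borel) Y {1..}"
    and sym: "\<And>i. i \<ge> 1 \<Longrightarrow> distr M borel (Y i) = distr M borel (\<lambda>\<omega>. - Y i \<omega>)"
    and h: "h \<in> borel_measurable D01_algebra" and n: "n \<ge> 1" and B: "B \<in> sets M"
    and low: "\<And>\<omega>. \<omega> \<in> B \<Longrightarrow> p \<le> measure_pmf.prob (signs {1..n})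
        {e. h (path (\<lambda>t e. student_process n 0 (\<lambda>i. e i * Y i \<omega>) t) e) < x}"
  shows "p * measure M B \<le> measure M {\<omega> \<in> space M. h (path (\<lambda>t \<omega>. student_process n 0 (\<lambda>i. Y i \<omega>) t) \<omega>) < x}"
proof -
  interpret prob_space M by fact
  let ?R = "signs {1..n}"
  have rv: "Y i \<in> borel_measurable M" if "i \<in> {1..n}" for i
    using Y that by (auto simp: indep_vars_def)
  let ?A = "\<lambda>e. {\<omega> \<in> space M. h (path (\<lambda>t \<omega>. student_process n 0 (\<lambda>i. e i * Y i \<omega>) t) \<omega>) < x}"
  have A [measurable]: "?A e \<in> sets M" for e
  proof -
    have "(\<lambda>\<omega>. h (path (\<lambda>t \<omega>. student_process n 0 (\<lambda>i. e i * Y i \<omega>) t) \<omega>)) \<in> borel_measurable M"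
      by (rule student_functional_measurable[OF h]) (use rv in auto)
    then show ?thesis by measurable
  qed
  have supp: "set_pmf ?R = PiE_dflt {1..n} 0 (\<lambda>_. {-1, 1})"
    by (simp add: signs_def set_Pi_pmf)
  \<comment> \<open>Finite support reduces the exchange of the two averages to linearity of the
    integral.\<close>
  have fin: "finite (set_pmf ?R)"
    unfolding supp by (intro finite_PiE_dflt) auto
  have path_eq: "path (\<lambda>t e. student_process n 0 (\<lambda>i. e i * Y i \<omega>) t) e =
      path (\<lambda>t \<omega>. student_process n 0 (\<lambda>i. e i * Y i \<omega>) t) \<omega>" for e \<omega>
    by (simp add: path_def)
  have prob_eq: "measure_pmf.prob ?R {e. h (path (\<lambda>t e. student_process n 0 (\<lambda>i. e i * Y i \<omega>) t) e) < x} =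
      (\<Sum>e\<in>set_pmf ?R. pmf ?R e * indicator (?A e) \<omega>)" if "\<omega> \<in> space M" for \<omega>
  proof -
    let ?S = "{e. h (path (\<lambda>t e. student_process n 0 (\<lambda>i. e i * Y i \<omega>) t) e) < x}"
    have "measure_pmf.prob ?R ?S = measure_pmf.expectation ?R (indicator ?S)" by simp
    also have "\<dots> = (\<Sum>e\<in>set_pmf ?R. pmf ?R e * indicator ?S e)"
      using fin by (subst integral_measure_pmf[where A="set_pmf ?R"]) auto
    also have "\<dots> = (\<Sum>e\<in>set_pmf ?R. pmf ?R e * indicator (?A e) \<omega>)"
      using that by (intro sum.cong refl) (simp add: indicator_def path_eq)
    finally show ?thesis .
  qed
  have "p * measure M B = (\<integral>\<omega>. p * indicator B \<omega> \<partial>M)"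
    using B by simp
  also have "\<dots> \<le> (\<integral>\<omega>. (\<Sum>e\<in>set_pmf ?R. pmf ?R e * indicator (?A e) \<omega>) \<partial>M)"
  proof (rule integral_mono)
    show "integrable M (\<lambda>\<omega>. p * indicator B \<omega>)"
      using B by (intro integrable_mult_right integrable_real_indicator) (auto simp: emeasure_eq_measure)
    show "integrable M (\<lambda>\<omega>. \<Sum>e\<in>set_pmf ?R. pmf ?R e * indicator (?A e) \<omega>)"
      using A by (intro Bochner_Integration.integrable_sum integrable_mult_right integrable_real_indicator)
        (auto simp: emeasure_eq_measure)
    fix \<omega> assume \<omega>: "\<omega> \<in> space M"
    show "p * indicator B \<omega> \<le> (\<Sum>e\<in>set_pmf ?R. pmf ?R e * indicator (?A e) \<omega>)"
    proof (cases "\<omega> \<in> B")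
      case True
      then show ?thesis using low[OF True, unfolded prob_eq[OF \<omega>]] by simp
    qed (simp add: sum_nonneg)
  qed
  also have "\<dots> = (\<Sum>e\<in>set_pmf ?R. pmf ?R e * measure M (?A e))"
    using A by (subst Bochner_Integration.integral_sum) (auto simp: emeasure_eq_measure intro!: integrable_real_indicator)
  also have "\<dots> = (\<Sum>e\<in>set_pmf ?R. pmf ?R e * measure M {\<omega> \<in> space M. h (path (\<lambda>t \<omega>. student_process n 0 (\<lambda>i. Y i \<omega>) t) \<omega>) < x})"
  proof (intro sum.cong refl arg_cong[of _ _ "times _"])
    fix e assume "e \<in> set_pmf ?R"
    then have ev: "e i \<in> {-1, 1}" if "i \<in> {1..n}" for i
      using that unfolding supp PiE_dflt_def by blast
    show "measure M (?A e) = measure M {\<omega> \<in> space M. h (path (\<lambda>t \<omega>. student_process n 0 (\<lambda>i. Y i \<omega>) t) \<omega>) < x}"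
      by (rule student_functional_sign_invariant[OF M Y _ h n]) (erule sym, erule ev)
  qed
  also have "\<dots> = measure M {\<omega> \<in> space M. h (path (\<lambda>t \<omega>. student_process n 0 (\<lambda>i. Y i \<omega>) t) \<omega>) < x}"
    using fin by (simp add: sum_distrib_right[symmetric] sum_pmf_eq_1)
  finally show ?thesis .
qed

lemma student_functional_liminf:
  assumes M: "prob_space M" and Y: "prob_space.indep_vars M (\<lambda>_. borel) Y {1..}"
    and sym: "\<And>i. i \<ge> 1 \<Longrightarrow> distr M borel (Y i) = distr M borel (\<lambda>\<omega>. - Y i \<omega>)"
    and ratio: "converges_in_prob M (\<lambda>n \<omega>. max_ratio n 0 (\<lambda>i. Y i \<omega>)) 0"
    and W: "wiener_process N W" and h: "h \<in> borel_measurable D01_algebra"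
    and cont: "AE w in distr N D01_algebra (path W). sup_continuous_at h w" and \<epsilon>: "\<epsilon> > 0"
  shows "eventually (\<lambda>n. measure M {\<omega> \<in> space M. h (path (\<lambda>t \<omega>. student_process n 0 (\<lambda>i. Y i \<omega>) t) \<omega>) < x}
    > measure N {\<omega> \<in> space N. h (path W \<omega>) < x} - \<epsilon>) sequentially"
proof -
  interpret M: prob_space M by fact
  interpret N: prob_space N using W by (simp add: wiener_process_def)
  let ?p = "measure N {\<omega> \<in> space N. h (path W \<omega>) < x}"
  have "\<epsilon> / 2 > 0" using \<epsilon> by simp
  from sign_student_uniform[OF W h cont this, of x] obtain \<delta> n0 where \<delta>: "\<delta> > 0"
    and low: "\<And>n y. n \<ge> n0 \<Longrightarrow> max_ratio n 0 y \<le> \<delta> \<Longrightarrow>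
      measure_pmf.prob (signs {1..n}) {e. h (path (\<lambda>t e. student_process n 0 (\<lambda>l. e l * y l) t) e) < x} > ?p - \<epsilon> / 2"
    by blast
  have rv: "Y i \<in> borel_measurable M" if "i \<ge> 1" for i
    using Y that by (auto simp: M.indep_vars_def)
  let ?Bad = "\<lambda>n. {\<omega> \<in> space M. \<bar>max_ratio n 0 (\<lambda>i. Y i \<omega>) - 0\<bar> > \<delta>}"
  have "(\<lambda>n. measure M (?Bad n)) \<longlonglongrightarrow> 0"
    using ratio \<delta> unfolding converges_in_prob_def by blast
  then have "eventually (\<lambda>n. measure M (?Bad n) < \<epsilon> / 2) sequentially"
    by (rule order_tendstoD(2)) (use \<epsilon> in simp)
  with eventually_ge_at_top[of "max 1 n0"] show ?thesis
  proof eventually_elim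
    case (elim n)
    let ?B = "space M - ?Bad n"
    let ?q = "measure M {\<omega> \<in> space M. h (path (\<lambda>t \<omega>. student_process n 0 (\<lambda>i. Y i \<omega>) t) \<omega>) < x}"
    have [measurable]: "(\<lambda>\<omega>. max_ratio n 0 (\<lambda>i. Y i \<omega>)) \<in> borel_measurable M"
      by (rule max_ratio_measurable) (use rv in auto)
    have Bad: "?Bad n \<in> sets M" by measurable
    have "(?p - \<epsilon> / 2) * measure M ?B \<le> ?q"
    proof (rule student_symmetrised_lower_bound[OF M Y sym h])
      show "n \<ge> 1" using elim by simp
      show "?B \<in> sets M" using Bad by auto
      show "?p - \<epsilon> / 2 \<le> measure_pmf.prob (signs {1..n})
          {e. h (path (\<lambda>t e. student_process n 0 (\<lambda>i. e i * Y i \<omega>) t) e) < x}" if "\<omega> \<in> ?B" for \<omega>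
      proof (rule less_imp_le, rule low)
        show "n \<ge> n0" using elim by simp
        show "max_ratio n 0 (\<lambda>i. Y i \<omega>) \<le> \<delta>" using that by auto
      qed
    qed
    moreover have "measure M ?B = 1 - measure M (?Bad n)"
      using Bad by (rule M.prob_compl)
    \<comment> \<open>Multiplying the lower bound by the probability of \<open>?B\<close> costs at
      most the probability of \<open>?Bad n\<close>, because the factor
      \<open>?p - \<epsilon> / 2\<close> is at most 1.\<close>
    moreover have "?p \<le> 1" by (rule N.prob_le_1)
    then have "(?p - \<epsilon> / 2) * measure M (?Bad n) \<le> 1 * measure M (?Bad n)"
      using \<epsilon> by (intro mult_right_mono) (linarith, simp)
    ultimately show ?case
      using elim by (simp add: right_diff_distrib)
  qed
qed

text \<open>\<open>student_functional_liminf\<close> for \<open>h\<close> at \<open>x\<close> bounds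
  P(T < x) from below; for \<open>- h\<close> at \<open>- x\<close> it bounds P(T > x) from below,
  that is, P(T \<le> x) from above. At a continuity point of the limit cdf there is no atom, so for
  the Wiener functional strict and weak inequality have the same probability.\<close>

lemma student_converges_if_ratio_to_0:
  assumes M: "prob_space M" and Y: "prob_space.indep_vars M (\<lambda>_. borel) Y {1..}"
    and sym: "\<And>i. i \<ge> 1 \<Longrightarrow> distr M borel (Y i) = distr M borel (\<lambda>\<omega>. - Y i \<omega>)"
    and ratio: "converges_in_prob M (\<lambda>n \<omega>. max_ratio n 0 (\<lambda>i. Y i \<omega>)) 0"
    and W: "wiener_process N W"
  shows "converges_in_distr_D01 M (\<lambda>n t \<omega>. student_process n 0 (\<lambda>i. Y i \<omega>) t) N W"
  unfolding converges_in_distr_D01_def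
proof (intro ballI impI)
  fix h assume h: "h \<in> borel_measurable D01_algebra"
    and cont: "AE w in distr N D01_algebra (path W). sup_continuous_at h w"
  interpret M: prob_space M by fact
  interpret N: prob_space N using W by (simp add: wiener_process_def)
  let ?T = "\<lambda>n \<omega>. h (path (\<lambda>t \<omega>. student_process n 0 (\<lambda>i. Y i \<omega>) t) \<omega>)" and ?W = "\<lambda>\<omega>. h (path W \<omega>)"
  have rv: "Y i \<in> borel_measurable M" if "i \<ge> 1" for i
    using Y that by (auto simp: M.indep_vars_def)
  have T [measurable]: "?T n \<in> borel_measurable M" for n
    by (rule student_functional_measurable[OF h]) (use rv in auto)
  have Wm [measurable]: "?W \<in> borel_measurable N"
    using path_wiener_measurable[OF W] h by (rule measurable_compose)
  have h': "(\<lambda>w. - h w) \<in> borel_measurable D01_algebra"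
    using h by simp
  have cont': "AE w in distr N D01_algebra (path W). sup_continuous_at (\<lambda>w. - h w) w"
    using cont by (rule eventually_mono) (simp add: sup_continuous_at_def abs_minus_commute)
  show "weak_conv_m (\<lambda>n. distr M borel (?T n)) (distr N borel ?W)"
    unfolding weak_conv_m_def weak_conv_def
  proof (intro allI impI tendstoI)
    fix x \<epsilon> :: real assume x: "isCont (cdf (distr N borel ?W)) x" and \<epsilon>: "\<epsilon> > 0"
    have cdfT: "cdf (distr M borel (?T n)) x = measure M {\<omega> \<in> space M. ?T n \<omega> \<le> x}" for n
      by (simp add: cdf_def measure_distr vimage_def Int_def conj_commute)
    have cdfW: "cdf (distr N borel ?W) x = measure N {\<omega> \<in> space N. ?W \<omega> \<le> x}"
      by (simp add: cdf_def measure_distr vimage_def Int_def conj_commute)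
    interpret W': real_distribution "distr N borel ?W"
      by (rule N.real_distribution_distr) simp
    have "measure (distr N borel ?W) {x} = 0"
      using x W'.isCont_cdf by blast
    then have null: "measure N {\<omega> \<in> space N. ?W \<omega> = x} = 0"
      by (simp add: measure_distr vimage_def Int_def conj_commute)
    have "{\<omega> \<in> space N. ?W \<omega> \<le> x} = {\<omega> \<in> space N. ?W \<omega> < x} \<union> {\<omega> \<in> space N. ?W \<omega> = x}" by auto
    then have W_less: "measure N {\<omega> \<in> space N. ?W \<omega> \<le> x} \<le> measure N {\<omega> \<in> space N. ?W \<omega> < x}"
      using measure_Un_le[of "{\<omega> \<in> space N. ?W \<omega> < x}" N "{\<omega> \<in> space N. ?W \<omega> = x}"] null by simp
    have compl: "measure M {\<omega> \<in> space M. - ?T n \<omega> < - x} = 1 - measure M {\<omega> \<in> space M. ?T n \<omega> \<le> x}" for n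
      by (subst M.prob_compl[symmetric]) (auto intro!: arg_cong[of _ _ "measure M"])
    have complW: "measure N {\<omega> \<in> space N. - ?W \<omega> < - x} = 1 - measure N {\<omega> \<in> space N. ?W \<omega> \<le> x}"
      by (subst N.prob_compl[symmetric]) (auto intro!: arg_cong[of _ _ "measure N"])
    have "eventually (\<lambda>n. measure M {\<omega> \<in> space M. ?T n \<omega> < x} > measure N {\<omega> \<in> space N. ?W \<omega> < x} - \<epsilon>) sequentially"
      by (rule student_functional_liminf[OF M Y sym ratio W h cont \<epsilon>])
    moreover have "eventually (\<lambda>n. measure M {\<omega> \<in> space M. - ?T n \<omega> < - x}
        > measure N {\<omega> \<in> space N. - ?W \<omega> < - x} - \<epsilon>) sequentially"
      by (rule student_functional_liminf[OF M Y sym ratio W h' cont' \<epsilon>])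
    ultimately show "eventually (\<lambda>n. dist (cdf (distr M borel (?T n)) x) (cdf (distr N borel ?W) x) < \<epsilon>) sequentially"
    proof eventually_elim
      case (elim n)
      have "measure M {\<omega> \<in> space M. ?T n \<omega> < x} \<le> measure M {\<omega> \<in> space M. ?T n \<omega> \<le> x}"
        by (intro M.finite_measure_mono) auto
      then show ?case
        using elim W_less unfolding cdfT cdfW compl complW dist_real_def abs_less_iff by linarith
    qed
  qed
qed

theorem theorem2:
  fixes M :: "'a measure" and Z :: "nat \<Rightarrow> 'a \<Rightarrow> real" and \<mu> :: real
    and N :: "'b measure" and W :: "real \<Rightarrow> 'b \<Rightarrow> real"
  assumes "prob_space M"
    and "prob_space.indep_vars M (\<lambda>_. borel) Z {1..}"
    and "\<And>i. i \<ge> 1 \<Longrightarrow> integrable M (Z i)"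
    and "\<And>i. i \<ge> 1 \<Longrightarrow> integral\<^sup>L M (Z i) = \<mu>"
    and "\<And>i. i \<ge> 1 \<Longrightarrow> distr M borel (\<lambda>\<omega>. Z i \<omega> - \<mu>) = distr M borel (\<lambda>\<omega>. \<mu> - Z i \<omega>)"
    and "wiener_process N W"
  shows "converges_in_distr_D01 M (\<lambda>n t \<omega>. student_process n \<mu> (\<lambda>i. Z i \<omega>) t) N W \<longleftrightarrow>
         converges_in_prob M (\<lambda>n \<omega>. max_ratio n \<mu> (\<lambda>i. Z i \<omega>)) 0"
proof -
  interpret prob_space M by fact
  let ?Y = "\<lambda>i \<omega>. Z i \<omega> - \<mu>"
  have Y: "indep_vars (\<lambda>_. borel) ?Y {1..}"
    using assms(2) by (rule indep_vars_compose2) simp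
  have rv: "?Y i \<in> borel_measurable M" if "i \<ge> 1" for i
    using Y that by (auto simp: indep_vars_def)
  have sym: "distr M borel (?Y i) = distr M borel (\<lambda>\<omega>. - ?Y i \<omega>)" if "i \<ge> 1" for i
    using assms(5)[OF that] by simp
  show ?thesis
    unfolding student_process_shift[of _ \<mu>] max_ratio_shift[of _ \<mu>]
  proof
    assume conv: "converges_in_distr_D01 M (\<lambda>n t \<omega>. student_process n 0 (\<lambda>i. Z i \<omega> - \<mu>) t) N W"
    show "converges_in_prob M (\<lambda>n \<omega>. max_ratio n 0 (\<lambda>i. Z i \<omega> - \<mu>)) 0"
      by (rule ratio_to_0_if_student_converges[OF assms(6) _ assms(1) conv]) (rule rv)
  next
    assume ratio: "converges_in_prob M (\<lambda>n \<omega>. max_ratio n 0 (\<lambda>i. Z i \<omega> - \<mu>)) 0"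
    show "converges_in_distr_D01 M (\<lambda>n t \<omega>. student_process n 0 (\<lambda>i. Z i \<omega> - \<mu>) t) N W"
      by (rule student_converges_if_ratio_to_0[OF assms(1) Y _ ratio assms(6)]) (rule sym)
  qed
qed

end
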